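(* Let $K$ be a finite field with $|K|=q$ elements and $\mathrm{char}(K)\neq 2$, and let $T_{\mathrm{Ass}}(UJ_2)\subseteq J(X)$ be the set of all $\mathbb{Z}_2$-graded polynomial identities of $UJ_2=UJ_2(K)$ endowed with the associative grading. Let $I'$ be the $T_{\mathbb{Z}_2}$-ideal of $J(X)$ generated by the polynomials \[(y_1,y_2,y_3),\ (z_1,y_1,y_2),\ (z_1,y_1,z_2),\ (z_1,z_2,z_3),\ (z_1z_2,z_3,z_4),\] \[(y_1^q-y_1)(y_2^q-y_2),\quad z_1^q-z_1,\quad (y_1^q-y_1)z_1.\] Then $I'=T_{\mathrm{Ass}}(UJ_2)$. Moreover, the set of all elements $g+I'$, where $g$ is of one of the following forms, is a basis of the quotient vector space $J(X)/I'$: (a) $g=\overline{Y}$; (b) $g=Y_1'Z_1'$; (c) $g=(Y_1'z_j)Z_2'$; (d) $g=(((y_iz_j)z_l)Y_1')Z_3'$, with $i\ge 1$; where - $\overline{Y}=y_1^{k_1}\cdots y_r^{k_r}$ with $r\geq 1$ and $(k_1,\ldots,k_r)\in\Lambda_r$; - $Y_1'=y_1^{k_1}\cdots y_r^{k_r}$ with $r\geq 1$ and $0\leq k_1,\ldots,k_r<q$; - $Z_1'=z_1^{t_1}\cdots z_s^{t_s}$ with $s\geq 1$, $0\leq t_1,\ldots,t_s<q$ and $t_1+\cdots+t_s>0$ even; - $Z_2'=z_j^{t_j}z_{j+1}^{t_{j+1}}\cdots z_s^{t_s}$ with $s\geq j\geq 1$, $0\leq t_j<q-1$, $0\leq t_{j+1},\ldots,t_s<q$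 and $t_j+\cdots+t_s\geq 0$ even; - $Z_3'=z_l^{t_l}z_{l+1}^{t_{l+1}}\cdots z_s^{t_s}$ with $1\leq j\leq l\leq s$, $0\leq t_{l+1},\ldots,t_s<q$ and $t_l+\cdots+t_s\geq 0$ even; moreover $0\leq t_l<q-1$ if $j<l$, and $0\leq t_l<q-2$ if $j=l$.
   Context: $UT_2(K)$ is the associative algebra of $2\times 2$ upper triangular matrices over $K$ with usual product $\cdot$, and $UJ_2=UJ_2(K)$ is the same vector space with the Jordan product $u\circ v=\frac12(u\cdot v+v\cdot u)$, written $uv$. A $\mathbb{Z}_2$-grading is a decomposition $UJ_2=(UJ_2)_0\oplus (UJ_2)_1$ with $(UJ_2)_i\circ(UJ_2)_j\subseteq (UJ_2)_{i+j}$. The associative grading is $(UJ_2)_0=\mathrm{span}\{e_{11}+e_{22},e_{12}\}$, $(UJ_2)_1=\mathrm{span}\{e_{11}-e_{22}\}$, where $e_{ij}$ are matrix units. $Y=\{y_1,y_2,\ldots\}$ and $Z=\{z_1,z_2,\ldots\}$ are disjoint infinite sets, $X=Y\cup Z$, and $J(X)$ is the free (unital) Jordan algebra over $K$ freely generated by $X$, with the $\mathbb{Z}_2$-grading in which each $y_i$ is even (degree $0$), each $z_i$ is odd (degree $1$), and the degree of a product of monomials is the sum of the degrees modulo $2$. A $T_{\mathbb{Z}_2}$-ideal is an ideal of $J(X)$ closed under all $\mathbb{Z}_2$-graded endomorphisms of $J(X)$; the $T_{\mathbb{Z}_2}$-ideal generated by a set is the smallest one containing it. An element $f(y_1,\ldots,y_s,z_1,\ldots,z_n)\in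 J(X)$ is a $\mathbb{Z}_2$-graded polynomial identity of $UJ_2$ if it vanishes under all substitutions of elements of $(UJ_2)_0$ for the $y_i$ and of elements of $(UJ_2)_1$ for the $z_i$. Associator: $(u,v,w)=(uv)w-u(vw)$. Products and powers without parentheses are left-normed: $f_1f_2\cdots f_n=(f_1\cdots f_{n-1})f_n$; the empty product is $1$. (Modulo $I'$, products of $y$'s only, and products of $z$'s only, do not depend on bracketing or order.) $\Lambda_n$ denotes the set of all $(s_1,\ldots,s_n)\in\mathbb{Z}^n$ such that $0\leq s_1,\ldots,s_n<2q$ and, if $s_i\geq q$ for some $i$, then $s_j<q$ for all $j\neq i$. *)

theory Defs
  imports "HOL-Analysis.Analysis"
begin

text \<open>
  Variables are numbered from 0: \<open>YVar i\<close> and \<open>ZVar i\<close> stand for \<open>y\<close> and \<open>z\<close> with index \<open>i + 1\<close>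
  of the usual enumeration from 1.
\<close>

datatype var = YVar nat | ZVar nat

datatype 'k jterm =
    TVar var
  | TOne
  | TZero
  | TAdd "'k jterm" "'k jterm"
  | TScale 'k "'k jterm"
  | TMul "'k jterm" "'k jterm"

text \<open>
  The least congruence on terms containing all instances of the laws of unital Jordan algebras.
  For characteristic different from 2 the last law is the usual definition of a (linear)
  Jordan algebra.
\<close>

inductive jeq :: "'k::field jterm \<Rightarrow> 'k jterm \<Rightarrow> bool" where
  jeq_refl: "jeq a a"
| jeq_sym: "jeq a b \<Longrightarrow> jeq b a"
| jeq_trans: "jeq a b \<Longrightarrow> jeq b c \<Longrightarrow> jeq a c"
| jeq_cong_add: "jeq a a' \<Longrightarrow> jeq b b' \<Longrightarrow> jeq (TAdd a b) (TAdd a' b')"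
| jeq_cong_scale: "jeq a a' \<Longrightarrow> jeq (TScale c a) (TScale c a')"
| jeq_cong_mul: "jeq a a' \<Longrightarrow> jeq b b' \<Longrightarrow> jeq (TMul a b) (TMul a' b')"
| jeq_add_assoc: "jeq (TAdd (TAdd a b) c) (TAdd a (TAdd b c))"
| jeq_add_comm: "jeq (TAdd a b) (TAdd b a)"
| jeq_add_zero: "jeq (TAdd TZero a) a"
| jeq_add_neg: "jeq (TAdd (TScale (-1) a) a) TZero"
| jeq_scale_one: "jeq (TScale 1 a) a"
| jeq_scale_scale: "jeq (TScale c (TScale d a)) (TScale (c * d) a)"
| jeq_scale_add_right: "jeq (TScale c (TAdd a b)) (TAdd (TScale c a) (TScale c b))"
| jeq_scale_add_left: "jeq (TScale (c + d) a) (TAdd (TScale c a) (TScale d a))"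
| jeq_mul_add: "jeq (TMul (TAdd a b) c) (TAdd (TMul a c) (TMul b c))"
| jeq_mul_scale: "jeq (TMul (TScale c a) b) (TScale c (TMul a b))"
| jeq_mul_one: "jeq (TMul TOne a) a"
| jeq_mul_comm: "jeq (TMul a b) (TMul b a)"
| jeq_jordan: "jeq (TMul (TMul (TMul a a) b) a) (TMul (TMul a a) (TMul b a))"

quotient_type (overloaded) 'k free_jordan = "'k::field jterm" / jeq
  by (intro equivpI reflpI sympI transpI) (fact jeq_refl, erule jeq_sym, erule (1) jeq_trans)

instantiation free_jordan :: (field) "{ab_group_add, one, times}"
begin

lift_definition zero_free_jordan :: "'a free_jordan" is TZero .
lift_definition one_free_jordan :: "'a free_jordan" is TOne .
lift_definition plus_free_jordan :: "'a free_jordan \<Rightarrow> 'a free_jordan \<Rightarrow> 'a free_jordan" is TAdd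
  by (rule jeq_cong_add)
lift_definition times_free_jordan :: "'a free_jordan \<Rightarrow> 'a free_jordan \<Rightarrow> 'a free_jordan" is TMul
  by (rule jeq_cong_mul)
lift_definition uminus_free_jordan :: "'a free_jordan \<Rightarrow> 'a free_jordan" is "TScale (-1)"
  by (rule jeq_cong_scale)
definition minus_free_jordan :: "'a free_jordan \<Rightarrow> 'a free_jordan \<Rightarrow> 'a free_jordan"
  where "minus_free_jordan a b = a + (- b)"

instance
proof
  fix a b c :: "'a free_jordan"
  show "a + b + c = a + (b + c)" by transfer (rule jeq_add_assoc)
  show "a + b = b + a" by transfer (rule jeq_add_comm)
  show "0 + a = a" by transfer (rule jeq_add_zero)
  show "- a + a = 0" by transfer (rule jeq_add_neg)
  show "a - b = a + - b" by (rule minus_free_jordan_def)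
qed

end

lift_definition jscale :: "'k::field \<Rightarrow> 'k free_jordan \<Rightarrow> 'k free_jordan" is TScale
  by (rule jeq_cong_scale)

lift_definition jvar :: "var \<Rightarrow> 'k::field free_jordan" is TVar .

abbreviation yv :: "nat \<Rightarrow> 'k::field free_jordan" where "yv i \<equiv> jvar (YVar i)"
abbreviation zv :: "nat \<Rightarrow> 'k::field free_jordan" where "zv i \<equiv> jvar (ZVar i)"

global_interpretation jord: vector_space jscale
proof
  fix c d :: "'k::field" and a b :: "'k free_jordan"
  show "jscale c (a + b) = jscale c a + jscale c b" by transfer (rule jeq_scale_add_right)
  show "jscale (c + d) a = jscale c a + jscale d a" by transfer (rule jeq_scale_add_left)
  show "jscale c (jscale d a) = jscale (c * d) a" by transfer (rule jeq_scale_scale)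
  show "jscale 1 a = a" by transfer (rule jeq_scale_one)
qed

lemma free_jordan_laws:
  fixes a b c :: "'k::field free_jordan"
  shows "(a + b) * c = a * c + b * c" "jscale k a * b = jscale k (a * b)"
    "1 * a = a" "a * b = b * a" "((a * a) * b) * a = (a * a) * (b * a)"
  by (transfer, rule jeq_mul_add, transfer, rule jeq_mul_scale, transfer, rule jeq_mul_one,
      transfer, rule jeq_mul_comm, transfer, rule jeq_jordan)

definition associator :: "'k::field free_jordan \<Rightarrow> 'k free_jordan \<Rightarrow> 'k free_jordan \<Rightarrow> 'k free_jordan"
  where "associator u v w = (u * v) * w - u * (v * w)"

text \<open>Left-normed products; the leading factor \<open>1\<close> is harmless and gives the empty product.\<close>

definition lprod :: "'k::field free_jordan list \<Rightarrow> 'k free_jordan"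
  where "lprod = foldl (*) 1"

definition lpow :: "'k::field free_jordan \<Rightarrow> nat \<Rightarrow> 'k free_jordan"
  where "lpow u n = lprod (replicate n u)"

text \<open>Degrees live in the two-element ring, the numeral type \<open>2\<close>.\<close>

inductive jmonomial :: "2 \<Rightarrow> 'k::field free_jordan \<Rightarrow> bool" where
  "jmonomial 0 1"
| "jmonomial 0 (yv i)"
| "jmonomial 1 (zv i)"
| "jmonomial d u \<Longrightarrow> jmonomial e v \<Longrightarrow> jmonomial (d + e) (u * v)"

definition jgrade :: "2 \<Rightarrow> 'k::field free_jordan set"
  where "jgrade d = jord.span {u. jmonomial d u}"

text \<open>Endomorphisms are those of the unital algebra, i.e. they preserve \<open>1\<close>.\<close>

definition graded_endo :: "('k::field free_jordan \<Rightarrow> 'k free_jordan) \<Rightarrow> bool"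
  where "graded_endo \<phi> \<longleftrightarrow>
    Vector_Spaces.linear jscale jscale \<phi> \<and> \<phi> 1 = 1 \<and>
    (\<forall>u v. \<phi> (u * v) = \<phi> u * \<phi> v) \<and> (\<forall>d. \<phi> ` jgrade d \<subseteq> jgrade d)"

definition jideal :: "'k::field free_jordan set \<Rightarrow> bool"
  where "jideal I \<longleftrightarrow> jord.subspace I \<and> (\<forall>a\<in>I. \<forall>u. a * u \<in> I \<and> u * a \<in> I)"

definition T_ideal :: "'k::field free_jordan set \<Rightarrow> bool"
  where "T_ideal I \<longleftrightarrow> jideal I \<and> (\<forall>\<phi>. graded_endo \<phi> \<longrightarrow> \<phi> ` I \<subseteq> I)"

definition T_ideal_gen :: "'k::field free_jordan set \<Rightarrow> 'k free_jordan set"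
  where "T_ideal_gen S = \<Inter> {I. T_ideal I \<and> S \<subseteq> I}"

definition mscale :: "'k::field \<Rightarrow> 'k^2^2 \<Rightarrow> 'k^2^2"
  where "mscale c A = (\<chi> i j. c * A $ i $ j)"

global_interpretation mats: vector_space "mscale :: 'k::field \<Rightarrow> _"
  by unfold_locales (simp_all add: mscale_def vec_eq_iff algebra_simps)

definition E :: "2 \<Rightarrow> 2 \<Rightarrow> 'k::field^2^2"
  where "E i j = axis i (axis j 1)"

definition jmul :: "'k::field^2^2 \<Rightarrow> 'k^2^2 \<Rightarrow> 'k^2^2"
  where "jmul u v = mscale (1/2) (u ** v + v ** u)"

definition UJ2 :: "('k::field^2^2) set"
  where "UJ2 = {A. A $ 2 $ 1 = 0}"

definition UJ2_ass_grade :: "2 \<Rightarrow> ('k::field^2^2) set"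
  where "UJ2_ass_grade d =
    (if d = 0 then mats.span {E 1 1 + E 2 2, E 1 2} else mats.span {E 1 1 - E 2 2})"

text \<open>
  A substitution of even elements for the \<open>y\<close> and odd elements for the \<open>z\<close> is given by its
  extension to a homomorphism of unital Jordan algebras; every such substitution has a unique
  extension, see \<open>ex1_ass_subst\<close> below.
\<close>

definition ass_subst :: "('k::field free_jordan \<Rightarrow> 'k^2^2) \<Rightarrow> bool"
  where "ass_subst \<phi> \<longleftrightarrow>
    Vector_Spaces.linear jscale mscale \<phi> \<and> range \<phi> \<subseteq> UJ2 \<and> \<phi> 1 = mat 1 \<and>
    (\<forall>u v. \<phi> (u * v) = jmul (\<phi> u) (\<phi> v)) \<and>
    (\<forall>i. \<phi> (yv i) \<in> UJ2_ass_grade 0) \<and> (\<forall>i. \<phi> (zv i) \<in> UJ2_ass_grade 1)"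

definition T_Ass :: "'k::field free_jordan set"
  where "T_Ass = {f. \<forall>\<phi>. ass_subst \<phi> \<longrightarrow> \<phi> f = 0}"

lemma mscale_matrix_mul:
  "mscale c A ** B = mscale c (A ** B)" "A ** mscale c B = mscale c (A ** B)"
  for A :: "'k::field^2^2"
  by (simp_all add: mscale_def matrix_matrix_mult_def vec_eq_iff sum_distrib_left algebra_simps)

lemma matrix_add_rdistr: "(A + B) ** C = A ** C + B ** C" for A :: "'k::field^2^2"
  by (simp add: matrix_matrix_mult_def vec_eq_iff sum.distrib algebra_simps)

lemma jmul_laws:
  fixes A B C :: "'k::field^2^2"
  shows "jmul (A + B) C = jmul A C + jmul B C" "jmul (mscale c A) B = mscale c (jmul A B)"
    "jmul A B = jmul B A" "jmul (jmul (jmul A A) B) A = jmul (jmul A A) (jmul B A)"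
proof -
  note d = jmul_def mscale_matrix_mul matrix_add_ldistrib matrix_add_rdistr
    mats.scale_right_distrib mats.scale_scale matrix_mul_assoc
  show "jmul (A + B) C = jmul A C + jmul B C"
    unfolding d by (simp only: ac_simps)
  show "jmul (mscale c A) B = mscale c (jmul A B)"
    unfolding d by (simp only: ac_simps)
  show "jmul A B = jmul B A"
    unfolding d by (simp only: ac_simps)
  show "jmul (jmul (jmul A A) B) A = jmul (jmul A A) (jmul B A)"
    unfolding d by (simp only: ac_simps)
qed

lemma two_neq_0:
  assumes "CHAR('k::field) \<noteq> 2"
  shows "(2::'k) \<noteq> 0"
proof
  assume "(2::'k) = 0"
  hence "(of_nat 2 :: 'k) = 0" by simp
  hence "CHAR('k) dvd 2" by (simp only: of_nat_eq_0_iff_char_dvd)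
  moreover have "CHAR('k) \<noteq> 1" by simp
  ultimately show False
    using assms two_is_prime_nat prime_nat_iff by metis
qed

primrec jeval :: "(var \<Rightarrow> 'k::field^2^2) \<Rightarrow> 'k jterm \<Rightarrow> 'k^2^2" where
  "jeval \<rho> (TVar v) = \<rho> v"
| "jeval \<rho> TOne = mat 1"
| "jeval \<rho> TZero = 0"
| "jeval \<rho> (TAdd a b) = jeval \<rho> a + jeval \<rho> b"
| "jeval \<rho> (TScale c a) = mscale c (jeval \<rho> a)"
| "jeval \<rho> (TMul a b) = jmul (jeval \<rho> a) (jeval \<rho> b)"

lemma jeval_cong:
  assumes "CHAR('k::field) \<noteq> 2" "jeq a b"
  shows "jeval \<rho> a = (jeval \<rho> b :: 'k^2^2)"
  using assms(2)
proof induction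
  case (jeq_mul_one a)
  show ?case
    using two_neq_0[OF assms(1)]
    by (simp add: jmul_def vec_eq_iff mscale_def field_simps)
next
  case (jeq_add_neg a)
  show ?case by (simp add: mats.scale_minus_left)
next
  case (jeq_mul_comm a b)
  show ?case by (simp add: jmul_laws(3)[of "jeval \<rho> a"])
next
  case (jeq_jordan a b)
  show ?case by (simp only: jeval.simps jmul_laws(4))
qed (simp_all add: jmul_laws(1,2) mats.scale_left_distrib mats.scale_right_distrib)

lemma UJ2_ass_grade_subset: "UJ2_ass_grade d \<subseteq> (UJ2 :: ('k::field^2^2) set)"
proof -
  have "mats.subspace (UJ2 :: ('k^2^2) set)"
    by (auto simp: mats.subspace_def UJ2_def mscale_def)
  moreover have "E 1 1 + E 2 2 \<in> (UJ2 :: ('k^2^2) set)" "E 1 2 \<in> (UJ2 :: ('k^2^2) set)"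
    "E 1 1 - E 2 2 \<in> (UJ2 :: ('k^2^2) set)"
    by (simp_all add: UJ2_def E_def axis_def)
  ultimately show ?thesis
    unfolding UJ2_ass_grade_def by (simp add: mats.span_minimal)
qed

lemma jmul_UJ2: "A \<in> UJ2 \<Longrightarrow> B \<in> UJ2 \<Longrightarrow> jmul A B \<in> UJ2"
  by (simp add: UJ2_def jmul_def mscale_def matrix_matrix_mult_def sum_2)

lemma jeval_UJ2:
  assumes "\<And>v. \<rho> v \<in> UJ2"
  shows "jeval \<rho> t \<in> UJ2"
proof (induction t)
  case (TMul a b)
  then show ?case by (simp add: jmul_UJ2)
qed (use assms in \<open>auto simp: UJ2_def mscale_def mat_def\<close>)

lemma ex1_ass_subst:
  fixes a b :: "nat \<Rightarrow> 'k::field^2^2"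
  assumes char: "CHAR('k) \<noteq> 2"
    and a: "\<And>i. a i \<in> UJ2_ass_grade 0" and b: "\<And>i. b i \<in> UJ2_ass_grade 1"
  shows "\<exists>!\<phi>. ass_subst \<phi> \<and> (\<forall>i. \<phi> (yv i) = a i \<and> \<phi> (zv i) = b i)"
proof -
  define \<rho> where "\<rho> v = (case v of YVar i \<Rightarrow> a i | ZVar i \<Rightarrow> b i)" for v
  have \<rho>: "\<rho> v \<in> UJ2" for v
    using a b UJ2_ass_grade_subset by (auto simp: \<rho>_def split: var.split)
  define \<phi> where "\<phi> f = jeval \<rho> (rep_free_jordan f)" for f
  have abs: "\<phi> (abs_free_jordan t) = jeval \<rho> t" for t
    unfolding \<phi>_def
    by (rule jeval_cong[OF char])
      (metis Quotient_free_jordan Quotient_rep_abs jeq_refl)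
  have "Vector_Spaces.linear jscale mscale \<phi>"
  proof (unfold_locales)
    fix x y :: "'k free_jordan" and c :: 'k
    show "\<phi> (x + y) = \<phi> x + \<phi> y"
      by (induct x, induct y) (simp add: plus_free_jordan.abs_eq abs)
    show "\<phi> (jscale c x) = mscale c (\<phi> x)"
      by (induct x) (simp add: jscale.abs_eq abs)
  qed
  moreover have "\<phi> (x * y) = jmul (\<phi> x) (\<phi> y)" for x y
    by (induct x, induct y) (simp add: times_free_jordan.abs_eq abs)
  moreover have "range \<phi> \<subseteq> UJ2"
    using jeval_UJ2[OF \<rho>] by (auto simp: \<phi>_def)
  moreover have "\<phi> 1 = mat 1"
    by (simp add: one_free_jordan.abs_eq abs)
  moreover have gen: "\<phi> (jvar v) = \<rho> v" for v
    by (simp add: jvar.abs_eq abs)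
  ultimately have ex: "ass_subst \<phi> \<and> (\<forall>i. \<phi> (yv i) = a i \<and> \<phi> (zv i) = b i)"
    using a b by (simp add: ass_subst_def \<rho>_def)
  have "\<psi> f = \<phi> f" if \<psi>: "ass_subst \<psi>" "\<forall>i. \<psi> (yv i) = a i \<and> \<psi> (zv i) = b i" for \<psi> f
  proof -
    interpret Vector_Spaces.linear jscale mscale \<psi> using \<psi>(1) by (simp add: ass_subst_def)
    have "\<psi> (abs_free_jordan t) = jeval \<rho> t" for t
    proof (induction t)
      case (TVar v)
      show ?case
        using \<psi>(2) by (cases v) (simp_all add: jvar.abs_eq[symmetric] \<rho>_def)
    next
      case TOne
      show ?case
        using \<psi>(1) by (simp add: ass_subst_def one_free_jordan.abs_eq[symmetric])
    next
      case TZero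
      show ?case
        using zero by (simp add: zero_free_jordan.abs_eq[symmetric])
    next
      case (TAdd s t)
      then show ?case by (simp add: plus_free_jordan.abs_eq[symmetric] add)
    next
      case (TScale c t)
      then show ?case by (simp add: jscale.abs_eq[symmetric] scale)
    next
      case (TMul s t)
      then show ?case
        using \<psi>(1) by (simp add: ass_subst_def times_free_jordan.abs_eq[symmetric])
    qed
    then show ?thesis by (induct f) (simp add: abs)
  qed
  then have "\<psi> = \<phi>" if "ass_subst \<psi> \<and> (\<forall>i. \<psi> (yv i) = a i \<and> \<psi> (zv i) = b i)" for \<psi>
    using that by (intro ext) blast
  with ex show ?thesis by (rule ex1I)
qed

definition ass_gens :: "nat \<Rightarrow> 'k::field free_jordan set"
  where "ass_gens q =
    {associator (yv 0) (yv 1) (yv 2),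
     associator (zv 0) (yv 0) (yv 1),
     associator (zv 0) (yv 0) (zv 1),
     associator (zv 0) (zv 1) (zv 2),
     associator (zv 0 * zv 1) (zv 2) (zv 3),
     (lpow (yv 0) q - yv 0) * (lpow (yv 1) q - yv 1),
     lpow (zv 0) q - zv 0,
     (lpow (yv 0) q - yv 0) * zv 0}"

definition I' :: "'k::{field,finite} free_jordan set"
  where "I' = T_ideal_gen (ass_gens CARD('k))"

lemma jideal_I': "jideal (I' :: 'k::{field,finite} free_jordan set)"
  unfolding I'_def T_ideal_gen_def jideal_def
proof (intro conjI ballI allI)
  show "jord.subspace (\<Inter> {I. T_ideal I \<and> ass_gens CARD('k) \<subseteq> I})"
    by (rule jord.subspace_Inter) (auto simp: T_ideal_def jideal_def)
qed (auto simp: T_ideal_def jideal_def)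

lemma subspace_I': "jord.subspace I'"
  by (rule conjunct1[OF jideal_I'[unfolded jideal_def]])

lemma diff_I': "f = g \<Longrightarrow> f - g \<in> I'"
  using jord.subspace_0[OF subspace_I'] by simp

quotient_type (overloaded) 'k jquot = "'k::{field,finite} free_jordan" / "\<lambda>f g. f - g \<in> I'"
  morphisms rep_jquot coset
proof (intro equivpI reflpI sympI transpI)
  fix f g h :: "'k free_jordan"
  show "f - f \<in> I'" by (rule diff_I') (rule refl)
  show "g - f \<in> I'" if "f - g \<in> I'" using jord.subspace_neg[OF subspace_I' that] by simp
  show "f - h \<in> I'" if "f - g \<in> I'" "g - h \<in> I'"
    using jord.subspace_add[OF subspace_I' that] by simp
qed

instantiation jquot :: ("{field,finite}") ab_group_add
begin

lift_definition zero_jquot :: "'a jquot" is 0 .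
lift_definition plus_jquot :: "'a jquot \<Rightarrow> 'a jquot \<Rightarrow> 'a jquot" is "(+)"
  by (simp only: add_diff_add jord.subspace_add[OF subspace_I'])
lift_definition uminus_jquot :: "'a jquot \<Rightarrow> 'a jquot" is uminus
  by (simp only: minus_diff_minus jord.subspace_neg[OF subspace_I'])
lift_definition minus_jquot :: "'a jquot \<Rightarrow> 'a jquot \<Rightarrow> 'a jquot" is "(-)"
proof -
  fix a b c d :: "'a free_jordan"
  assume "a - b \<in> I'" "c - d \<in> I'"
  from jord.subspace_diff[OF subspace_I' this]
  show "a - c - (b - d) \<in> I'" by (simp add: algebra_simps)
qed

instance
proof
  fix a b c :: "'a jquot"
  show "a + b + c = a + (b + c)" by transfer (rule diff_I', rule add.assoc)
  show "a + b = b + a" by transfer (rule diff_I', rule add.commute)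
  show "0 + a = a" by transfer (rule diff_I', rule add_0_left)
  show "- a + a = 0" by transfer (rule diff_I', rule left_minus)
  show "a - b = a + - b" by transfer (rule diff_I', rule diff_conv_add_uminus)
qed

end

lift_definition qscale :: "'k::{field,finite} \<Rightarrow> 'k jquot \<Rightarrow> 'k jquot" is jscale
  by (simp only: jord.scale_right_diff_distrib[symmetric] jord.subspace_scale[OF subspace_I'])

global_interpretation quot: vector_space qscale
proof
  fix c d :: "'k::{field,finite}" and a b :: "'k jquot"
  show "qscale c (a + b) = qscale c a + qscale c b"
    by transfer (rule diff_I', rule jord.scale_right_distrib)
  show "qscale (c + d) a = qscale c a + qscale d a"
    by transfer (rule diff_I', rule jord.scale_left_distrib)
  show "qscale c (qscale d a) = qscale (c * d) a"
    by transfer (rule diff_I', rule jord.scale_scale)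
  show "qscale 1 a = a"
    by transfer (rule diff_I', rule jord.scale_one)
qed

lemma coset_eq_iff: "coset f = coset g \<longleftrightarrow> f - g \<in> I'"
  by (rule jquot.abs_eq_iff)

text \<open>Only the values \<open>s 0, \<dots>, s (n - 1)\<close> matter.\<close>

definition Lambda :: "nat \<Rightarrow> nat \<Rightarrow> (nat \<Rightarrow> nat) set"
  where "Lambda q n = {s. (\<forall>i<n. s i < 2 * q) \<and>
    (\<forall>i<n. q \<le> s i \<longrightarrow> (\<forall>j<n. j \<noteq> i \<longrightarrow> s j < q))}"

text \<open>Half-open index ranges: \<open>ymon k r\<close> involves \<open>r\<close> variables, \<open>zmon t j s\<close> the indices from
  \<open>j\<close> to \<open>s - 1\<close>.\<close>

definition ymon :: "(nat \<Rightarrow> nat) \<Rightarrow> nat \<Rightarrow> 'k::field free_jordan"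
  where "ymon k r = lprod (map (\<lambda>i. lpow (yv i) (k i)) [0..<r])"

definition zmon :: "(nat \<Rightarrow> nat) \<Rightarrow> nat \<Rightarrow> nat \<Rightarrow> 'k::field free_jordan"
  where "zmon t j s = lprod (map (\<lambda>i. lpow (zv i) (t i)) [j..<s])"

definition form_a :: "nat \<Rightarrow> 'k::field free_jordan set"
  where "form_a q = {ymon k r | k r. 1 \<le> r \<and> k \<in> Lambda q r}"

definition form_b :: "nat \<Rightarrow> 'k::field free_jordan set"
  where "form_b q = {ymon k r * zmon t 0 s | k r t s.
    1 \<le> r \<and> (\<forall>i<r. k i < q) \<and>
    1 \<le> s \<and> (\<forall>i<s. t i < q) \<and> (\<Sum>i<s. t i) > 0 \<and> even (\<Sum>i<s. t i)}"

definition form_c :: "nat \<Rightarrow> 'k::field free_jordan set"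
  where "form_c q = {(ymon k r * zv j) * zmon t j s | k r j t s.
    1 \<le> r \<and> (\<forall>i<r. k i < q) \<and>
    j < s \<and> t j < q - 1 \<and> (\<forall>i\<in>{j<..<s}. t i < q) \<and> even (\<Sum>i=j..<s. t i)}"

definition form_d :: "nat \<Rightarrow> 'k::field free_jordan set"
  where "form_d q = {(((yv i * zv j) * zv l) * ymon k r) * zmon t l s | i j l k r t s.
    1 \<le> r \<and> (\<forall>m<r. k m < q) \<and>
    j \<le> l \<and> l < s \<and> (\<forall>m\<in>{l<..<s}. t m < q) \<and> even (\<Sum>m=l..<s. t m) \<and>
    (j < l \<longrightarrow> t l < q - 1) \<and> (j = l \<longrightarrow> t l < q - 2)}"

end

theory Submission
  imports Defs
begin

text \<open>
  Write even elements of \<open>UJ2\<close> as \<open>a + b e\<close> and odd ones as \<open>c h\<close>, where \<open>e = E 1 2\<close>, \<open>h = E 1 1 - E 2 2\<close>;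
  then \<open>e e = e h = 0\<close> and \<open>h h = 1\<close>.

  Modulo \<open>I'\<close>, the linearized Jordan identity yields \<open>(u x) x' = u ^ q (x x')\<close> for even \<open>u\<close> and odd
  \<open>x\<close>, \<open>x'\<close>. Hence the products of a monomial in the \<open>y\<close> and a monomial in the \<open>z\<close> span the quotient,
  and the last three generators of \<open>I'\<close> reduce the exponents.

  The reduced monomials are independent modulo the graded identities: a vanishing combination gives a
  polynomial in the scalars \<open>a\<close>, \<open>c\<close> which vanishes as a function together with all its formal partial
  derivatives in the \<open>a\<close> variables, these being the coefficients of \<open>e\<close>. Reducing modulo
  \<open>a\<^sub>j ^ q = a\<^sub>j\<close> does not commute with the formal derivative, and comparing the two shows that the
  terms with an exponent at least \<open>q\<close> have coefficient \<open>0\<close>; independence of reduced monomials as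
  functions does the rest.
\<close>

subsection \<open>Polynomial functions over finite fields\<close>

text \<open>Values alone cannot tell \<open>y ^ q\<close> from \<open>y\<close>: if \<open>a\<close>
  is the scalar part of an even variable, \<open>a ^ q * m\<close> and \<open>a * m\<close> are the
  same function. The coordinate of \<open>e\<close> separates them. As q = 0 in the field, the
  formal derivative of \<open>a ^ q * m\<close> is \<open>a * m'\<close>, whereas the function
  \<open>a * m\<close> has derivative \<open>m + a * m'\<close>, up to a correction when
  \<open>m\<close> has degree q - 1 in \<open>a\<close>. The excess \<open>m\<close> is what forces
  the coefficients of large exponents to vanish. Equality of the two ideals and linear independence
  share one argument: the reduced monomials span modulo \<open>I'\<close>, and they are independent
  even modulo the possibly larger set of all identities. Forms (b) to (d) never have to be rewritten
  by hand: once the two ideals coincide, equality of cosets is checked by evaluating both sides in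
  \<open>UJ2\<close>.\<close>

lemma power_card_eq_same: "x ^ CARD('k) = x" for x :: "'k::{field,finite}"
proof (cases "x = 0")
  case False
  have "x * (\<Prod>y\<in>UNIV-{0}. x * y) = x * x ^ (CARD('k) - 1) * \<Prod>(UNIV-{0})"
    by (simp add: prod.distrib mult_ac)
  also have "x * x ^ (CARD('k) - 1) = x ^ Suc (CARD('k) - 1)"
    by (rule power_Suc[symmetric])
  also have "Suc (CARD('k) - 1) = CARD('k)"
    using finite_UNIV_card_ge_0[where ?'a = 'k] by simp
  also have "(\<Prod>y\<in>UNIV-{0}. x * y) = \<Prod>(UNIV-{0})"
    by (rule prod.reindex_bij_witness[of _ "\<lambda>y. y / x" "\<lambda>y. x * y"]) (use False in auto)
  finally show ?thesis by simp
qed (use finite_UNIV_card_ge_0[where ?'a = 'k] in auto)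

lemma of_nat_card_eq_0: "of_nat CARD('k) = (0 :: 'k::{field,finite})"
proof -
  have "(\<Sum>y\<in>UNIV. y + 1 :: 'k) = (\<Sum>y\<in>UNIV. y)"
    by (rule sum.reindex_bij_witness[of _ "\<lambda>y. y - 1" "\<lambda>y. y + 1"]) auto
  then show ?thesis by (simp add: sum.distrib)
qed

lemma odd_card_field:
  assumes "CHAR('k::{field,finite}) \<noteq> 2"
  shows "odd CARD('k)"
proof
  assume "even CARD('k)"
  then have "(-1 :: 'k) = 1" using power_card_eq_same[of "-1 :: 'k"] by simp
  then have "(2::'k) = 0" by (metis add.right_inverse one_add_one)
  with two_neq_0[OF assms] show False ..
qed

lemma card_field_ge_3:
  assumes "CHAR('k::{field,finite}) \<noteq> 2"
  shows "CARD('k) \<ge> 3"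
proof -
  have "card {0, 1 :: 'k} \<le> CARD('k)" by (rule card_mono) auto
  then have "CARD('k) \<ge> 2" by simp
  with odd_card_field[OF assms] show ?thesis by (cases "CARD('k) = 2") auto
qed

text \<open>The substitution \<open>y \<mapsto> g * y\<close> multiplies the sum by
  \<open>g ^ m\<close>, so a nonzero \<open>g\<close> with \<open>g ^ m \<noteq> 1\<close> forces it
  to vanish. If there were no such \<open>g\<close>, the polynomial x^(m+1) - x of degree below q
  would have q roots. For \<open>m = 0\<close> the sum is q itself.\<close>

lemma sum_power_eq_0:
  assumes "m < CARD('k::{field,finite}) - 1"
  shows "(\<Sum>y\<in>UNIV. y ^ m :: 'k) = 0"
proof (cases "m = 0")
  case True
  then show ?thesis by (simp add: of_nat_card_eq_0)
next
  case False
  have "\<exists>g :: 'k. g \<noteq> 0 \<and> g ^ m \<noteq> 1"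
  proof (rule ccontr)
    assume *: "\<nexists>g :: 'k. g \<noteq> 0 \<and> g ^ m \<noteq> 1"
    define p :: "'k poly" where "p = monom 1 (Suc m) - monom 1 1"
    have "coeff p 1 = -1" using False by (simp add: p_def)
    then have "p \<noteq> 0" by auto
    moreover have "degree p \<le> Suc m"
      unfolding p_def by (rule degree_diff_le) (auto simp: degree_monom_eq)
    moreover have "poly p x = 0" for x
      using * by (cases "x = 0") (auto simp: p_def poly_monom)
    then have "{x. poly p x = 0} = UNIV" by auto
    ultimately have "CARD('k) \<le> Suc m"
      using card_poly_roots_bound[of p] by simp
    with assms show False by simp
  qed
  then obtain g :: 'k where g: "g \<noteq> 0" "g ^ m \<noteq> 1" by blast
  have "(\<Sum>y\<in>UNIV. (g * y) ^ m) = (\<Sum>y\<in>UNIV. y ^ m)"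
    by (rule sum.reindex_bij_witness[of _ "\<lambda>y. y / g" "\<lambda>y. g * y"]) (use g in auto)
  then have "g ^ m * (\<Sum>y\<in>UNIV. y ^ m) = (\<Sum>y\<in>UNIV. y ^ m)"
    by (simp add: power_mult_distrib sum_distrib_left)
  with g show ?thesis by simp
qed

text \<open>The reflection \<open>y \<mapsto> 2 * x - y\<close> changes the sign of every summand;
  its fixed point \<open>y = x\<close> contributes nothing by the convention
  \<open>1 / 0 = 0\<close>.\<close>

lemma sum_inverse_eq_0:
  assumes "CHAR('k::{field,finite}) \<noteq> 2"
  shows "(\<Sum>y\<in>UNIV. 1 / (x - y) :: 'k) = 0"
proof -
  have "(\<Sum>y\<in>UNIV. 1 / (x - y)) = (\<Sum>y\<in>UNIV. - (1 / (x - y)))"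
    by (rule sum.reindex_bij_witness[of _ "\<lambda>y. 2 * x - y" "\<lambda>y. 2 * x - y"])
      (auto simp: divide_simps)
  then have "2 * (\<Sum>y\<in>UNIV. 1 / (x - y)) = 0"
    by (simp add: sum_negf)
  with two_neq_0[OF assms] show ?thesis by simp
qed

text \<open>
  By Lagrange interpolation over the finite field, this is the partial derivative of the reduced
  polynomial representing \<open>F\<close>; the term with \<open>y = x j\<close> vanishes because of \<open>1 / 0 = 0\<close>.
\<close>

definition fdiff :: "'v \<Rightarrow> (('v \<Rightarrow> 'k::{field,finite}) \<Rightarrow> 'k) \<Rightarrow> ('v \<Rightarrow> 'k) \<Rightarrow> 'k"
  where "fdiff j F x = (\<Sum>y\<in>UNIV. F (x(j := y)) / (x j - y))"

lemma fdiff_mult_other: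
  assumes "i \<noteq> j"
  shows "fdiff j (\<lambda>x. x i * F x) x = x i * fdiff j F x"
  using assms by (simp add: fdiff_def sum_distrib_left)

text \<open>A Leibniz rule with a correction. Up to sign, the last sum is the coefficient of the
  (q-1)-st power of \<open>x j\<close> in \<open>F\<close>; it appears because multiplication by
  \<open>x j\<close> creates a q-th power, which has to be reduced to the first power before
  differentiating.\<close>

lemma fdiff_mult_same:
  "fdiff j (\<lambda>x. x j * F x) x = x j * fdiff j F x + F x - (\<Sum>y\<in>UNIV. F (x(j := y)))"
proof -
  \<comment> \<open>For \<open>y = x j\<close> both quotients are 0, and the last summand
    compensates for \<open>- F x\<close>.\<close>
  have "y * F (x(j := y)) / (x j - y)
      = x j * (F (x(j := y)) / (x j - y)) - F (x(j := y)) + (if y = x j then F x else 0)" for y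
    by (simp add: field_simps)
  then show ?thesis
    by (simp add: fdiff_def sum.distrib sum_subtractf sum_distrib_left)
qed

lemma fdiff_sum:
  "fdiff j (\<lambda>x. \<Sum>s\<in>A. c s * F s x) x = (\<Sum>s\<in>A. c s * fdiff j (F s) x)"
  unfolding fdiff_def
  by (simp add: sum_divide_distrib sum_distrib_left, subst sum.swap, simp)

section \<open>Monomials as functions\<close>

definition mono_fun :: "'v multiset \<Rightarrow> ('v \<Rightarrow> 'k::comm_monoid_mult) \<Rightarrow> 'k"
  where "mono_fun S x = \<Prod>\<^sub># (image_mset x S)"

lemma mono_fun_simps [simp]:
  "mono_fun {#} x = 1" "mono_fun (add_mset v S) x = x v * mono_fun S x"
  "mono_fun (S + T) x = mono_fun S x * mono_fun T x"
  by (simp_all add: mono_fun_def)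

lemma mono_fun_replicate_mset [simp]: "mono_fun (replicate_mset n v) x = x v ^ n"
  by (induction n) simp_all

lemma mono_fun_split:
  "mono_fun S x = x v ^ count S v * mono_fun (filter_mset (\<lambda>w. w \<noteq> v) S) x"
  by (induction S) (auto simp: mult_ac)

lemma mono_fun_upd_other: "v \<notin># S \<Longrightarrow> mono_fun S (x(v := y)) = mono_fun S x"
  unfolding mono_fun_def by (metis fun_upd_other image_mset_cong)

lemma mono_fun_upd:
  "mono_fun S (x(v := y)) = y ^ count S v * mono_fun (filter_mset (\<lambda>w. w \<noteq> v) S) x"
  by (subst mono_fun_split[of _ _ v]) (simp add: mono_fun_upd_other)

lemma count_mono_fun:
  fixes x :: "'v \<Rightarrow> 'k::comm_semiring_1"
  shows "of_nat (count S v) * mono_fun S x = x v * (of_nat (count S v) * mono_fun (S - {#v#}) x)"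
  by (cases "v \<in># S") (auto simp: not_in_iff mult_ac dest!: multi_member_split)

lemma count_mono_fun_add_mset:
  fixes x :: "'v \<Rightarrow> 'k::comm_semiring_1"
  assumes "w \<noteq> v"
  shows "of_nat (count S v) * mono_fun (add_mset w S - {#v#}) x
    = x w * (of_nat (count S v) * mono_fun (S - {#v#}) x)"
  using assms by (cases "v \<in># S") (auto simp: diff_union_swap2 not_in_iff mult_ac)

text \<open>The variables are multiplied on one at a time. If the new variable is \<open>j\<close>,
  the correction in the Leibniz rule contains a power sum whose exponent is below q - 1, since the
  new exponent is still below q; hence it vanishes.\<close>

lemma fdiff_mono_fun:
  fixes x :: "'v \<Rightarrow> 'k::{field,finite}"
  assumes "CHAR('k) \<noteq> 2" "count S j < CARD('k)"
  shows "fdiff j (mono_fun S) x = of_nat (count S j) * mono_fun (S - {#j#}) x"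
  using assms(2)
proof (induction S)
  case empty
  show ?case using sum_inverse_eq_0[OF assms(1)] by (simp add: fdiff_def)
next
  case (add v S)
  have *: "mono_fun (add_mset v S) = (\<lambda>x :: 'v \<Rightarrow> 'k. x v * mono_fun S x)" by (rule ext) simp
  have IH: "fdiff j (mono_fun S) x = of_nat (count S j) * mono_fun (S - {#j#}) x"
    using add by (auto split: if_splits)
  show ?case
  proof (cases "v = j")
    case False
    with IH show ?thesis
      using count_mono_fun_add_mset[OF False, of S x] by (simp add: * fdiff_mult_other)
  next
    case True
    have "(\<Sum>y\<in>UNIV. mono_fun S (x(j := y))) = 0"
      using add.prems True sum_power_eq_0[of "count S j", where ?'k = 'k]
      by (simp add: mono_fun_upd sum_distrib_right[symmetric])
    with True IH show ?thesis
      using count_mono_fun[of S j x] by (auto simp: * fdiff_mult_same algebra_simps)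
  qed
qed

lemma poly_fun_coeff_eq_0:
  fixes c :: "nat \<Rightarrow> 'k::{field,finite}"
  assumes "\<And>x. (\<Sum>i<CARD('k). c i * x ^ i) = 0" "i < CARD('k)"
  shows "c i = 0"
proof -
  define p where "p = (\<Sum>i<CARD('k). monom (c i) i)"
  have "poly p x = 0" for x using assms(1) by (simp add: p_def poly_sum poly_monom)
  then have "{x. poly p x = 0} = UNIV" by auto
  moreover have "degree p < CARD('k)"
    unfolding p_def using finite_UNIV_card_ge_0[where ?'a = 'k]
    by (intro degree_sum_less) (auto intro: le_less_trans[OF degree_monom_le])
  ultimately have "p = 0" using card_poly_roots_bound[of p] by auto
  then have "coeff p i = 0" by simp
  then show ?thesis using assms(2) by (simp add: p_def coeff_sum)
qed

text \<open>Induction on the set of variables. With all variables except \<open>v\<close> fixed, the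
  relation is a polynomial in \<open>x v\<close> of degree below q that vanishes at q points. Its
  coefficients are therefore 0, and each of them is a relation in fewer variables.\<close>

lemma mono_fun_independent:
  fixes C :: "'v multiset \<Rightarrow> 'k::{field,finite}"
  assumes "finite A" "\<And>S v. S \<in> A \<Longrightarrow> count S v < CARD('k)"
    and "\<And>x. (\<Sum>S\<in>A. C S * mono_fun S x) = 0" and "S \<in> A"
  shows "C S = 0"
proof -
  define V where "V = (\<Union>S\<in>A. set_mset S)"
  have "finite V" "\<And>S. S \<in> A \<Longrightarrow> set_mset S \<subseteq> V" using assms(1) by (auto simp: V_def)
  then show ?thesis using assms
  proof (induction V arbitrary: A C S)
    case empty
    then have "A = {{#}}" by force
    with empty show ?case by auto
  next
    case (insert v V)
    let ?f = "filter_mset (\<lambda>w. w \<noteq> v)"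
    define B where "B = {T \<in> A. count T v = count S v}"
    have inj: "inj_on ?f {T. count T v = m}" for m
    proof (rule inj_onI, unfold mem_Collect_eq)
      fix T T' assume *: "count T v = m" "count T' v = m" "?f T = ?f T'"
      show "T = T'"
      proof (rule multiset_eqI)
        fix w show "count T w = count T' w"
        proof -
          have "count (?f T) w = count (?f T') w" by (simp only: *(3))
          then show ?thesis using *(1,2) by (cases "w = v") simp_all
        qed
      qed
    qed
    \<comment> \<open>Removing \<open>v\<close> is injective on monomials with equal exponent of
      \<open>v\<close>, so the coefficients can be carried over to the shortened monomials.\<close>
    define C' where "C' T = C (the_inv_into B ?f T)" for T
    have injB: "inj_on ?f B" by (rule inj_on_subset[OF inj[of "count S v"]]) (auto simp: B_def)
    have C': "C' (?f T) = C T" if "T \<in> B" for T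
      using that by (simp add: C'_def the_inv_into_f_f[OF injB])
    have "(\<Sum>T\<in>?f ` B. C' T * mono_fun T x) = 0" for x
    proof -
      define c where "c m = (\<Sum>T\<in>{T\<in>A. count T v = m}. C T * mono_fun (?f T) x)" for m
      have "(\<Sum>m<CARD('k). c m * y ^ m) = 0" for y
      proof -
        have "0 = (\<Sum>T\<in>A. C T * mono_fun T (x(v := y)))" using insert.prems(4) by simp
        also have "\<dots> = (\<Sum>m<CARD('k). \<Sum>T\<in>{T\<in>A. count T v = m}. C T * mono_fun T (x(v := y)))"
          using insert.prems(2,3) by (intro sum.group[symmetric]) auto
        also have "\<dots> = (\<Sum>m<CARD('k). c m * y ^ m)"
          by (simp add: c_def mono_fun_upd sum_distrib_left mult_ac)
        finally show ?thesis ..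
      qed
      then have "c (count S v) = 0"
        by (rule poly_fun_coeff_eq_0) (use insert.prems in auto)
      moreover have "c (count S v) = (\<Sum>T\<in>?f ` B. C' T * mono_fun T x)"
        unfolding c_def B_def[symmetric] by (simp add: sum.reindex[OF injB] C')
      ultimately show ?thesis by simp
    qed
    moreover have "finite (?f ` B)" using insert.prems(2) by (simp add: B_def)
    moreover have "set_mset T \<subseteq> V" if "T \<in> ?f ` B" for T
      using that insert.prems(1) by (fastforce simp: B_def)
    moreover have "count T w < CARD('k)" if "T \<in> ?f ` B" for T w
      using that insert.prems(3) by (auto simp: B_def)
    moreover have "S \<in> B" using insert.prems(5) by (simp add: B_def)
    ultimately show ?case using insert.IH[of "?f ` B" C' "?f S"] C'[of S] by auto
  qed
qed

lemma mono_fun_independent_family: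
  fixes C :: "'s \<Rightarrow> 'k::{field,finite}"
  assumes "finite A" "inj_on f A" "\<And>s v. s \<in> A \<Longrightarrow> count (f s) v < CARD('k)"
    and "\<And>x. (\<Sum>s\<in>A. C s * mono_fun (f s) x) = 0" and "s \<in> A"
  shows "C s = 0"
proof -
  let ?C = "\<lambda>S. C (the_inv_into A f S)"
  have "(\<Sum>S\<in>f ` A. ?C S * mono_fun S x) = 0" for x
    using assms(4)[of x] by (simp add: sum.reindex[OF assms(2)] the_inv_into_f_f[OF assms(2)])
  then have "?C (f s) = 0"
    using assms by (intro mono_fun_independent[of "f ` A" ?C "f s"]) auto
  then show ?thesis using assms by (simp add: the_inv_into_f_f)
qed

text \<open>Applying \<open>fdiff j\<close> to the first relation and subtracting the second leaves
  only the correction of the Leibniz rule at \<open>i = j\<close>: \<open>Q j\<close> equals the sum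
  of its values over all choices of \<open>x j\<close>. Hence it does not depend on
  \<open>x j\<close>, so that sum is q times \<open>Q j\<close>, which is 0.\<close>

lemma fdiff_relation_trivial:
  fixes P :: "('v \<Rightarrow> 'k::{field,finite}) \<Rightarrow> 'k"
  assumes "finite I" "j \<in> I"
    and rel: "\<And>x. P x + (\<Sum>i\<in>I. x i * Q i x) = 0"
    and drel: "\<And>x. fdiff j P x + (\<Sum>i\<in>I. x i * fdiff j (Q i) x) = 0"
  shows "Q j x = 0"
proof -
  have avg: "Q j x = (\<Sum>y\<in>UNIV. Q j (x(j := y)))" for x
  proof -
    have "fdiff j (\<lambda>x. P x + (\<Sum>i\<in>I. x i * Q i x)) x
        = fdiff j P x + (\<Sum>i\<in>I. fdiff j (\<lambda>x. x i * Q i x) x)"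
      unfolding fdiff_def
      by (simp add: add_divide_distrib sum.distrib sum_divide_distrib, subst sum.swap, simp)
    moreover have "fdiff j (\<lambda>x. P x + (\<Sum>i\<in>I. x i * Q i x)) x = 0"
      by (simp only: rel) (simp add: fdiff_def)
    moreover have "fdiff j (\<lambda>x. x i * Q i x) x = x i * fdiff j (Q i) x
        + (if i = j then Q j x - (\<Sum>y\<in>UNIV. Q j (x(j := y))) else 0)" for i
      by (simp add: fdiff_mult_other fdiff_mult_same)
    ultimately have "fdiff j P x + ((\<Sum>i\<in>I. x i * fdiff j (Q i) x)
        + (Q j x - (\<Sum>y\<in>UNIV. Q j (x(j := y))))) = 0"
      using assms(1,2) by (simp add: sum.distrib)
    then have "Q j x - (\<Sum>y\<in>UNIV. Q j (x(j := y))) = 0"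
      by (simp only: add.assoc[symmetric] drel add_0_left)
    then show ?thesis by simp
  qed
  have "Q j (x(j := y)) = Q j x" for y
    by (subst (1 2) avg) (simp only: fun_upd_upd)
  then have "Q j x = (\<Sum>y\<in>(UNIV :: 'k set). Q j x)"
    by (subst avg) (simp only:)
  then show ?thesis by (simp add: of_nat_card_eq_0)
qed

lemma replicate_subset_mset: "n \<le> count M i \<Longrightarrow> M = M - replicate_mset n i + replicate_mset n i"
  by (simp add: count_le_replicate_mset_subset_eq)

text \<open>In a monomial with a large exponent of \<open>v\<close> a factor \<open>v ^ q\<close> is
  split off. As a value this factor is just \<open>x v\<close>, and under formal differentiation it
  is a constant because q = 0 in the field; so the two assumptions become the two relations of
  \<open>fdiff_relation_trivial\<close>. Derivatives are demanded only for variables with some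
  exponent at least q, since evaluation in \<open>UJ2\<close> provides none for odd
  variables.\<close>

lemma mono_fun_derivative_independent:
  fixes C :: "'s \<Rightarrow> 'k::{field,finite}" and f :: "'s \<Rightarrow> 'v multiset"
  assumes char: "CHAR('k) \<noteq> 2" and A: "finite A" "inj_on f A"
    and lt: "\<And>s v. s \<in> A \<Longrightarrow> count (f s) v < 2 * CARD('k)"
    and one: "\<And>s v w. s \<in> A \<Longrightarrow> v \<noteq> w \<Longrightarrow> CARD('k) \<le> count (f s) v \<Longrightarrow> count (f s) w < CARD('k)"
    and val: "\<And>x. (\<Sum>s\<in>A. C s * mono_fun (f s) x) = 0"
    and der: "\<And>x s v. s \<in> A \<Longrightarrow> CARD('k) \<le> count (f s) v \<Longrightarrow>
      (\<Sum>s\<in>A. C s * (of_nat (count (f s) v) * mono_fun (f s - {#v#}) x)) = 0"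
    and s: "s \<in> A"
  shows "C s = 0"
proof -
  let ?q = "CARD('k)"
  define I where "I = {v. \<exists>s\<in>A. ?q \<le> count (f s) v}"
  define U where "U = {s\<in>A. \<forall>v. count (f s) v < ?q}"
  define W where "W v = {s\<in>A. ?q \<le> count (f s) v}" for v
  define g where "g v s = f s - replicate_mset ?q v" for v s
  have q: "?q > 0" using card_field_ge_3[OF char] by simp
  have fg: "f s = g v s + replicate_mset ?q v" if "s \<in> W v" for s v
    unfolding g_def using that by (intro replicate_subset_mset) (simp add: W_def)
  have glt: "count (g v s) w < ?q" if "s \<in> W v" for s v w
    using that lt[of s v] one[of s v w] by (cases "w = v") (auto simp: W_def g_def)
  have "I \<subseteq> (\<Union>s\<in>A. set_mset (f s))"
  proof
    fix v assume "v \<in> I"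
    then obtain s where "s \<in> A" "?q \<le> count (f s) v" by (auto simp: I_def)
    with q have "v \<in># f s" by (intro count_inI) simp
    with \<open>s \<in> A\<close> show "v \<in> (\<Union>s\<in>A. set_mset (f s))" by blast
  qed
  then have finI: "finite I" by (rule finite_subset) (use A in auto)
  have finU: "finite U" and finW: "\<And>v. finite (W v)" using A by (auto simp: U_def W_def)
  have cover: "s \<in> U \<or> (\<exists>v\<in>I. s \<in> W v)" if "s \<in> A" for s
    unfolding U_def W_def I_def using that leI by blast
  \<comment> \<open>\<open>one\<close> makes the variable with a large exponent unique, so the sets
    \<open>W v\<close> are disjoint.\<close>
  have split: "(\<Sum>s\<in>A. h s) = (\<Sum>s\<in>U. h s) + (\<Sum>v\<in>I. \<Sum>s\<in>W v. h s)" for h :: "'s \<Rightarrow> 'k"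
  proof -
    have "A = U \<union> (\<Union>v\<in>I. W v)" using cover by (auto simp: U_def W_def)
    then have "(\<Sum>s\<in>A. h s) = (\<Sum>s\<in>U \<union> (\<Union>v\<in>I. W v). h s)" by simp
    also have "\<dots> = (\<Sum>s\<in>U. h s) + (\<Sum>s\<in>(\<Union>v\<in>I. W v). h s)"
      by (rule sum.union_disjoint) (use finU finI finW in \<open>auto simp: U_def W_def not_less[symmetric]\<close>)
    also have "(\<Sum>s\<in>(\<Union>v\<in>I. W v). h s) = (\<Sum>v\<in>I. \<Sum>s\<in>W v. h s)"
    proof (rule sum.UNION_disjoint[OF finI])
      show "\<forall>v\<in>I. \<forall>w\<in>I. v \<noteq> w \<longrightarrow> W v \<inter> W w = {}"
        using one by (fastforce simp: W_def)
    qed (use finW in auto)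
    finally show ?thesis .
  qed
  define P where "P x = (\<Sum>s\<in>U. C s * mono_fun (f s) x)" for x
  define Q where "Q v x = (\<Sum>s\<in>W v. C s * mono_fun (g v s) x)" for v x
  have valW: "mono_fun (f s) x = x v * mono_fun (g v s) x" if "s \<in> W v" for s v and x :: "'v \<Rightarrow> 'k"
    by (simp add: fg[OF that] power_card_eq_same)
  have derW: "of_nat (count (f s) w) * mono_fun (f s - {#w#}) x
      = x v * fdiff w (mono_fun (g v s)) x" if "s \<in> W v" for s v w and x :: "'v \<Rightarrow> 'k"
  proof (cases "w \<in># g v s")
    case True
    then have "f s - {#w#} = (g v s - {#w#}) + replicate_mset ?q v"
      unfolding fg[OF that] by simp
    moreover have "of_nat (count (f s) w) = (of_nat (count (g v s) w) :: 'k)"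
      by (simp add: fg[OF that] of_nat_card_eq_0)
    ultimately show ?thesis
      by (simp add: fdiff_mono_fun[OF char glt[OF that]] power_card_eq_same)
  next
    case False
    then have "of_nat (count (f s) w) = (0 :: 'k)"
      by (simp add: fg[OF that] of_nat_card_eq_0 not_in_iff)
    with False show ?thesis
      by (simp add: fdiff_mono_fun[OF char glt[OF that]] not_in_iff)
  qed
  have rel: "P x + (\<Sum>v\<in>I. x v * Q v x) = 0" for x
    using val[of x] unfolding split P_def Q_def
    by (simp add: valW sum_distrib_left mult.left_commute cong: sum.cong)
  have drel: "fdiff w P x + (\<Sum>v\<in>I. x v * fdiff w (Q v) x) = 0" if "w \<in> I" for w x
  proof -
    have "(\<Sum>s\<in>A. C s * (of_nat (count (f s) w) * mono_fun (f s - {#w#}) x)) = 0"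
      using that der by (auto simp: I_def)
    moreover have "fdiff w P x = (\<Sum>s\<in>U. C s * (of_nat (count (f s) w) * mono_fun (f s - {#w#}) x))"
      unfolding P_def fdiff_sum
      by (intro sum.cong refl) (simp add: fdiff_mono_fun[OF char] U_def)
    ultimately show ?thesis
      unfolding split Q_def fdiff_sum
      by (simp add: derW sum_distrib_left mult.left_commute cong: sum.cong)
  qed
  have Q0: "Q v x = 0" if "v \<in> I" for v x
    using finI that rel drel[OF that] by (rule fdiff_relation_trivial)
  have W0: "C s = 0" if "s \<in> W v" "v \<in> I" for s v
  proof (rule mono_fun_independent_family[OF finW, of "g v" v])
    show "inj_on (g v) (W v)"
      by (rule inj_onI) (metis (no_types, lifting) fg inj_onD[OF A(2)] W_def mem_Collect_eq)
  qed (use that Q0[OF that(2)] glt in \<open>auto simp: Q_def\<close>)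
  then have "P x = 0" for x using rel[of x] by (simp add: Q0)
  then have "C s = 0" if "s \<in> U" for s
    using that finU inj_on_subset[OF A(2)]
    by (intro mono_fun_independent_family[of U f C s]) (auto simp: P_def U_def)
  with W0 cover[OF s] show ?thesis by blast
qed

subsection \<open>Free Jordan algebras\<close>

lemma free_jordan_mult_simps [simp]:
  fixes a b :: "'k::field free_jordan"
  shows "0 * a = 0" "a * 0 = 0" "1 * a = a" "a * 1 = a"
    "jscale c a * b = jscale c (a * b)" "a * jscale c b = jscale c (a * b)"
proof -
  show z: "0 * a = 0" for a :: "'k free_jordan"
    using free_jordan_laws(1)[of 0 0 a] by simp
  show "a * 0 = 0" by (simp add: z free_jordan_laws(4)[of a])
  show "1 * a = a" "a * 1 = a" by (simp_all add: free_jordan_laws(3) free_jordan_laws(4)[of a])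
  show s: "jscale c a * b = jscale c (a * b)" for a b :: "'k free_jordan"
    by (rule free_jordan_laws(2))
  show "a * jscale c b = jscale c (a * b)"
    by (simp only: free_jordan_laws(4)[of a] s)
qed

lemma free_jordan_distrib:
  fixes a b c :: "'k::field free_jordan"
  shows "(a + b) * c = a * c + b * c" "c * (a + b) = c * a + c * b"
    "(- a) * c = - (a * c)" "c * (- a) = - (c * a)"
    "(a - b) * c = a * c - b * c" "c * (a - b) = c * a - c * b"
proof -
  show l: "(a + b) * c = a * c + b * c" for a b c :: "'k free_jordan"
    by (rule free_jordan_laws(1))
  show r: "c * (a + b) = c * a + c * b" for a b c :: "'k free_jordan"
    by (simp only: free_jordan_laws(4)[of c] l)
  show ml: "(- a) * c = - (a * c)" for a c :: "'k free_jordan"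
    using l[of "- a" a c] by (simp add: eq_neg_iff_add_eq_0)
  show mr: "c * (- a) = - (c * a)" for a c :: "'k free_jordan"
    by (simp only: free_jordan_laws(4)[of c] ml)
  show "(a - b) * c = a * c - b * c" "c * (a - b) = c * a - c * b"
    by (simp_all only: diff_conv_add_uminus l r ml mr)
qed

lemma double_eq_0_free_jordan:
  fixes a :: "'k::field free_jordan"
  assumes "CHAR('k) \<noteq> 2" "a + a = 0"
  shows "a = 0"
proof -
  have "jscale 2 a = 0"
    using assms(2) jord.scale_left_distrib[of 1 1 a] by simp
  then show ?thesis using two_neq_0[OF assms(1)] by simp
qed

text \<open>The cubic law is polarized with integer combinations only and a single division by 2, so
  that fields with few elements, including those of characteristic 3, cause no difficulty.\<close>

lemma jordan_linearized:
  fixes a b c d :: "'k::field free_jordan"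
  assumes "CHAR('k) \<noteq> 2"
  shows "((a * c) * b) * d + ((a * d) * b) * c + ((c * d) * b) * a
    = (a * c) * (b * d) + (a * d) * (b * c) + (c * d) * (b * a)" (is "?l = ?r")
proof -
  define T where "T x y z = ((x * y) * b) * z - (x * y) * (b * z)" for x y z
  have T_add: "T (x + x') y z = T x y z + T x' y z" "T x y (z + z') = T x y z + T x y z'"
    for x x' y z z' by (simp_all add: T_def free_jordan_distrib algebra_simps)
  have T_comm: "T x y z = T y x z" for x y z
    by (simp add: T_def free_jordan_laws(4)[of x y])
  have T_add2: "T y (x + x') z = T y x z + T y x' z" for x x' y z
    by (simp only: T_comm[of y] T_add)
  have cube: "T x x x = 0" for x by (simp add: T_def free_jordan_laws(5))
  define G where "G x y = T x x y + T x y x + T y x x" for x y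
  have G_anti: "G x y + G y x = 0" for x y
  proof -
    have "G x y + G y x = T (x + y) (x + y) (x + y) - T x x x - T y y y"
      by (simp add: G_def T_add T_add2)
    then show ?thesis by (simp add: cube)
  qed
  \<comment> \<open>\<open>G\<close> is quadratic in its first and additive in its second argument.
    The differences therefore leave exactly the six terms multilinear in \<open>a\<close>,
    \<open>c\<close>, \<open>d\<close>; they coincide in pairs by symmetry of
    \<open>T\<close>.\<close>
  have "(T a c d + T a d c + T c d a) + (T c a d + T d a c + T d c a)
      = (G (a + c) d + G d (a + c)) - (G a d + G d a) - (G c d + G d c)"
    by (simp add: G_def T_add T_add2)
  then have "(T a c d + T a d c + T c d a) + (T a c d + T a d c + T c d a) = 0"
    by (simp add: G_anti T_comm[of c a] T_comm[of d])
  then have "T a c d + T a d c + T c d a = 0"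
    by (rule double_eq_0_free_jordan[OF assms])
  then show ?thesis by (simp add: T_def algebra_simps)
qed

lemma lprod_simps [simp]:
  "lprod [] = 1" "lprod (xs @ [x]) = lprod xs * x"
  by (simp_all add: lprod_def)

lemma lpow_simps [simp]: "lpow u 0 = 1" "lpow u (Suc n) = lpow u n * u"
proof -
  show "lpow u 0 = 1" by (simp add: lpow_def)
  have "replicate (Suc n) u = replicate n u @ [u]" by (simp add: replicate_append_same)
  then show "lpow u (Suc n) = lpow u n * u" by (simp only: lpow_def lprod_simps)
qed

section \<open>Substitutions and the grading of the free algebra\<close>

primrec term_subst :: "(var \<Rightarrow> 'k::field free_jordan) \<Rightarrow> 'k jterm \<Rightarrow> 'k free_jordan" where
  "term_subst \<sigma> (TVar v) = \<sigma> v"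
| "term_subst \<sigma> TOne = 1"
| "term_subst \<sigma> TZero = 0"
| "term_subst \<sigma> (TAdd a b) = term_subst \<sigma> a + term_subst \<sigma> b"
| "term_subst \<sigma> (TScale c a) = jscale c (term_subst \<sigma> a)"
| "term_subst \<sigma> (TMul a b) = term_subst \<sigma> a * term_subst \<sigma> b"

lemma term_subst_cong: "jeq a b \<Longrightarrow> term_subst \<sigma> a = term_subst \<sigma> b"
proof (induction rule: jeq.induct)
  case (jeq_mul_comm a b)
  show ?case by (simp add: free_jordan_laws(4)[of "term_subst \<sigma> a"])
next
  case (jeq_jordan a b)
  show ?case by (simp only: term_subst.simps free_jordan_laws(5))
qed (simp_all add: free_jordan_distrib jord.scale_left_distrib jord.scale_right_distrib add_ac)

lift_definition jsubst :: "(var \<Rightarrow> 'k::field free_jordan) \<Rightarrow> 'k free_jordan \<Rightarrow> 'k free_jordan"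
  is term_subst by (rule term_subst_cong)

lemma jsubst_simps [simp]:
  "jsubst \<sigma> (jvar v) = \<sigma> v" "jsubst \<sigma> 1 = 1" "jsubst \<sigma> 0 = 0"
  "jsubst \<sigma> (a + b) = jsubst \<sigma> a + jsubst \<sigma> b"
  "jsubst \<sigma> (- a) = - jsubst \<sigma> a"
  "jsubst \<sigma> (a - b) = jsubst \<sigma> a - jsubst \<sigma> b"
  "jsubst \<sigma> (jscale c a) = jscale c (jsubst \<sigma> a)"
  "jsubst \<sigma> (a * b) = jsubst \<sigma> a * jsubst \<sigma> b"
proof -
  show add: "jsubst \<sigma> (a + b) = jsubst \<sigma> a + jsubst \<sigma> b" for a b by transfer simp
  show neg: "jsubst \<sigma> (- a) = - jsubst \<sigma> a" for a by transfer simp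
  show "jsubst \<sigma> (a - b) = jsubst \<sigma> a - jsubst \<sigma> b"
    by (simp only: diff_conv_add_uminus add neg)
  show "jsubst \<sigma> (jvar v) = \<sigma> v" by transfer simp
  show "jsubst \<sigma> 1 = 1" by transfer simp
  show "jsubst \<sigma> 0 = 0" by transfer simp
  show "jsubst \<sigma> (jscale c a) = jscale c (jsubst \<sigma> a)" by transfer simp
  show "jsubst \<sigma> (a * b) = jsubst \<sigma> a * jsubst \<sigma> b" by transfer simp
qed

lemma jsubst_lpow [simp]: "jsubst \<sigma> (lpow u n) = lpow (jsubst \<sigma> u) n"
  by (induction n) simp_all

lemma free_jordan_induct [case_names var one add scale mult]:
  assumes "\<And>v. P (jvar v)" "P 1" "\<And>a b. P a \<Longrightarrow> P b \<Longrightarrow> P (a + b)"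
    "\<And>c a. P a \<Longrightarrow> P (jscale c a)" "\<And>a b. P a \<Longrightarrow> P b \<Longrightarrow> P (a * b)"
  shows "P (f :: 'k::field free_jordan)"
proof -
  have "P (abs_free_jordan t)" for t
  proof (induction t)
    case TZero
    show ?case using assms(4)[OF assms(2), of 0]
      by (simp add: zero_free_jordan.abs_eq[symmetric])
  qed (simp_all add: assms jvar.abs_eq[symmetric] one_free_jordan.abs_eq[symmetric]
      plus_free_jordan.abs_eq[symmetric] jscale.abs_eq[symmetric] times_free_jordan.abs_eq[symmetric])
  then show ?thesis by (induct f) simp
qed

lemma subspace_jgrade: "jord.subspace (jgrade d)"
  by (simp add: jgrade_def)

lemma jgrade_one [simp]: "1 \<in> jgrade 0"
  and jgrade_yv [simp]: "yv i \<in> jgrade 0"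
  and jgrade_zv [simp]: "zv i \<in> jgrade 1"
  by (auto simp: jgrade_def intro: jmonomial.intros jord.span_base)

lemma jgrade_closed [simp]:
  "0 \<in> jgrade d" "a \<in> jgrade d \<Longrightarrow> b \<in> jgrade d \<Longrightarrow> a + b \<in> jgrade d"
  "a \<in> jgrade d \<Longrightarrow> - a \<in> jgrade d" "a \<in> jgrade d \<Longrightarrow> jscale c a \<in> jgrade d"
  "a \<in> jgrade d \<Longrightarrow> b \<in> jgrade d \<Longrightarrow> a - b \<in> jgrade d"
  by (simp_all add: jord.subspace_0[OF subspace_jgrade] jord.subspace_add[OF subspace_jgrade]
      jord.subspace_neg[OF subspace_jgrade] jord.subspace_scale[OF subspace_jgrade]
      jord.subspace_diff[OF subspace_jgrade])

lemma span_mult_closed: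
  assumes "\<And>a b. a \<in> A \<Longrightarrow> b \<in> B \<Longrightarrow> a * b \<in> jord.span C"
    and "u \<in> jord.span A" "v \<in> jord.span B"
  shows "u * v \<in> jord.span C"
proof -
  have "a * v \<in> jord.span C" if "a \<in> A" for a
    using assms(3)
    by (induction rule: jord.span_induct_alt)
      (auto simp: free_jordan_distrib jord.span_zero that
        intro!: jord.span_add jord.span_scale assms(1))
  with assms(2) show ?thesis
    by (induction rule: jord.span_induct_alt)
      (auto simp: free_jordan_distrib jord.span_zero intro!: jord.span_add jord.span_scale)
qed

lemma jgrade_mult: "a \<in> jgrade d \<Longrightarrow> b \<in> jgrade e \<Longrightarrow> a * b \<in> jgrade (d + e)"
  unfolding jgrade_def
  by (rule span_mult_closed[of "{u. jmonomial d u}" "{u. jmonomial e u}"])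
    (auto intro: jmonomial.intros jord.span_base)

lemma jgrade_mult_cases [simp]:
  "a \<in> jgrade 0 \<Longrightarrow> b \<in> jgrade 0 \<Longrightarrow> a * b \<in> jgrade 0"
  "a \<in> jgrade 0 \<Longrightarrow> b \<in> jgrade 1 \<Longrightarrow> a * b \<in> jgrade 1"
  "a \<in> jgrade 1 \<Longrightarrow> b \<in> jgrade 0 \<Longrightarrow> a * b \<in> jgrade 1"
  "a \<in> jgrade 1 \<Longrightarrow> b \<in> jgrade 1 \<Longrightarrow> a * b \<in> jgrade 0"
proof -
  have "(1 + 1 :: 2) = 0" by simp
  then show "a \<in> jgrade 1 \<Longrightarrow> b \<in> jgrade 1 \<Longrightarrow> a * b \<in> jgrade 0"
    using jgrade_mult[of a 1 b 1] by (simp only:)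
qed (use jgrade_mult[of a 0 b 0] jgrade_mult[of a 0 b 1] jgrade_mult[of a 1 b 0] in simp_all)

lemma lpow_jgrade_0 [simp]: "u \<in> jgrade 0 \<Longrightarrow> lpow u n \<in> jgrade 0"
  by (induction n) simp_all

lemma graded_endo_jsubst:
  assumes "\<And>i. \<sigma> (YVar i) \<in> jgrade 0" "\<And>i. \<sigma> (ZVar i) \<in> jgrade 1"
  shows "graded_endo (jsubst \<sigma>)"
proof -
  have lin: "Vector_Spaces.linear jscale jscale (jsubst \<sigma>)"
    by unfold_locales simp_all
  have mon: "jsubst \<sigma> u \<in> jgrade d" if "jmonomial d u" for d u
    using that by (induction rule: jmonomial.induct) (simp_all add: assms jgrade_mult)
  have "jsubst \<sigma> u \<in> jgrade d" if "u \<in> jgrade d" for d u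
    using that[unfolded jgrade_def]
    by (induction rule: jord.span_induct_alt) (simp_all add: mon)
  then show ?thesis unfolding graded_endo_def
    by (auto simp: lin)
qed

section \<open>The generators evaluated at homogeneous elements\<close>

lemma I'_closed [simp]:
  fixes a b :: "'k::{field,finite} free_jordan"
  shows "0 \<in> (I' :: 'k free_jordan set)" "a \<in> I' \<Longrightarrow> b \<in> I' \<Longrightarrow> a + b \<in> I'" "a \<in> I' \<Longrightarrow> - a \<in> I'"
  "a \<in> I' \<Longrightarrow> b \<in> I' \<Longrightarrow> a - b \<in> I'" "a \<in> I' \<Longrightarrow> jscale c a \<in> I'"
  "a \<in> I' \<Longrightarrow> a * b \<in> I'" "a \<in> I' \<Longrightarrow> b * a \<in> I'"
  using jideal_I'[where ?'k = 'k]
  by (simp_all add: jord.subspace_0[OF subspace_I'] jord.subspace_add[OF subspace_I']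
      jord.subspace_neg[OF subspace_I'] jord.subspace_scale[OF subspace_I']
      jord.subspace_diff[OF subspace_I'] jideal_def)

lemma I'_mult_cong:
  assumes "a - a' \<in> I'" "b - b' \<in> I'"
  shows "a * b - a' * b' \<in> I'"
proof -
  have "a * b - a' * b' = (a - a') * b + a' * (b - b')" by (simp add: free_jordan_distrib)
  with assms show ?thesis by simp
qed

lemma I'_jsubst:
  fixes f :: "'k::{field,finite} free_jordan"
  assumes "f \<in> ass_gens CARD('k)"
    and "\<And>i. \<sigma> (YVar i) \<in> jgrade 0" "\<And>i. \<sigma> (ZVar i) \<in> jgrade 1"
  shows "jsubst \<sigma> f \<in> I'"
  unfolding I'_def T_ideal_gen_def
  using assms(1) graded_endo_jsubst[of \<sigma>, OF assms(2,3)] by (fastforce simp: T_ideal_def)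

lemma I'_identities:
  fixes u v w :: "'k::{field,finite} free_jordan"
  shows "\<lbrakk>u \<in> jgrade 0; v \<in> jgrade 0; w \<in> jgrade 0\<rbrakk> \<Longrightarrow> (u * v) * w - u * (v * w) \<in> I'"
    "\<lbrakk>x1 \<in> jgrade 1; u \<in> jgrade 0; v \<in> jgrade 0\<rbrakk> \<Longrightarrow> (x1 * u) * v - x1 * (u * v) \<in> I'"
    "\<lbrakk>x1 \<in> jgrade 1; u \<in> jgrade 0; x2 \<in> jgrade 1\<rbrakk> \<Longrightarrow> (x1 * u) * x2 - x1 * (u * x2) \<in> I'"
    "\<lbrakk>x1 \<in> jgrade 1; x2 \<in> jgrade 1; x3 \<in> jgrade 1\<rbrakk> \<Longrightarrow> (x1 * x2) * x3 - x1 * (x2 * x3) \<in> I'"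
    "\<lbrakk>x1 \<in> jgrade 1; x2 \<in> jgrade 1; x3 \<in> jgrade 1; x4 \<in> jgrade 1\<rbrakk>
      \<Longrightarrow> ((x1 * x2) * x3) * x4 - (x1 * x2) * (x3 * x4) \<in> I'"
    "\<lbrakk>u \<in> jgrade 0; v \<in> jgrade 0\<rbrakk>
      \<Longrightarrow> (lpow u CARD('k) - u) * (lpow v CARD('k) - v) \<in> I'"
    "x1 \<in> jgrade 1 \<Longrightarrow> lpow x1 CARD('k) - x1 \<in> I'"
    "\<lbrakk>u \<in> jgrade 0; x1 \<in> jgrade 1\<rbrakk> \<Longrightarrow> (lpow u CARD('k) - u) * x1 \<in> I'"
proof -
  \<comment> \<open>One substitution serves all eight generators; variables absent from a generator
    receive fillers of the right degree, \<open>1\<close> for even and \<open>zv 0\<close> for odd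
    ones.\<close>
  define \<sigma> where "\<sigma> u v w x1 x2 x3 x4 t = (case t of
      YVar n \<Rightarrow> if n = 0 then u else if n = 1 then v else w
    | ZVar n \<Rightarrow> if n = 0 then x1 else if n = 1 then x2 else if n = 2 then x3 else x4)"
    for u v w x1 x2 x3 x4 :: "'k free_jordan" and t
  have *: "\<forall>f\<in>ass_gens CARD('k). jsubst (\<sigma> u v w x1 x2 x3 x4) f \<in> I'"
    if "u \<in> jgrade 0" "v \<in> jgrade 0" "w \<in> jgrade 0"
      "x1 \<in> jgrade 1" "x2 \<in> jgrade 1" "x3 \<in> jgrade 1" "x4 \<in> jgrade 1"
    for u v w x1 x2 x3 x4
    by (intro ballI I'_jsubst) (auto simp: \<sigma>_def that)
  note ** = ass_gens_def associator_def \<sigma>_def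
  show "\<lbrakk>u \<in> jgrade 0; v \<in> jgrade 0; w \<in> jgrade 0\<rbrakk> \<Longrightarrow> (u * v) * w - u * (v * w) \<in> I'"
    using *[of u v w "zv 0" "zv 0" "zv 0" "zv 0"] by (simp add: **)
  show "\<lbrakk>x1 \<in> jgrade 1; u \<in> jgrade 0; v \<in> jgrade 0\<rbrakk> \<Longrightarrow> (x1 * u) * v - x1 * (u * v) \<in> I'"
    using *[of u v 1 x1 "zv 0" "zv 0" "zv 0"] by (simp add: **)
  show "\<lbrakk>x1 \<in> jgrade 1; u \<in> jgrade 0; x2 \<in> jgrade 1\<rbrakk> \<Longrightarrow> (x1 * u) * x2 - x1 * (u * x2) \<in> I'"
    using *[of u 1 1 x1 x2 "zv 0" "zv 0"] by (simp add: **)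
  show "\<lbrakk>x1 \<in> jgrade 1; x2 \<in> jgrade 1; x3 \<in> jgrade 1\<rbrakk> \<Longrightarrow> (x1 * x2) * x3 - x1 * (x2 * x3) \<in> I'"
    using *[of 1 1 1 x1 x2 x3 "zv 0"] by (simp add: **)
  show "\<lbrakk>x1 \<in> jgrade 1; x2 \<in> jgrade 1; x3 \<in> jgrade 1; x4 \<in> jgrade 1\<rbrakk>
      \<Longrightarrow> ((x1 * x2) * x3) * x4 - (x1 * x2) * (x3 * x4) \<in> I'"
    using *[of 1 1 1 x1 x2 x3 x4] by (simp add: **)
  show "\<lbrakk>u \<in> jgrade 0; v \<in> jgrade 0\<rbrakk>
      \<Longrightarrow> (lpow u CARD('k) - u) * (lpow v CARD('k) - v) \<in> I'"
    using *[of u v 1 "zv 0" "zv 0" "zv 0" "zv 0"] by (simp add: **)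
  show "x1 \<in> jgrade 1 \<Longrightarrow> lpow x1 CARD('k) - x1 \<in> I'"
    using *[of 1 1 1 x1 "zv 0" "zv 0" "zv 0"] by (simp add: **)
  show "\<lbrakk>u \<in> jgrade 0; x1 \<in> jgrade 1\<rbrakk> \<Longrightarrow> (lpow u CARD('k) - u) * x1 \<in> I'"
    using *[of u 1 1 x1 "zv 0" "zv 0" "zv 0"] by (simp add: **)
qed

subsection \<open>Even and odd part modulo \<open>I'\<close>\<close>

text \<open>
  Modulo \<open>I'\<close> the even part is an associative commutative ring acting on the odd part, which carries a
  symmetric product with even values. That \<open>1\<close> is nonzero is not known at this point (and may depend
  on the characteristic), so the even part is not made an instance of \<open>comm_ring_1\<close>.
\<close>

quotient_type (overloaded) 'k even_part = "'k::{field,finite} free_jordan" /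
    partial: "\<lambda>f g. f \<in> jgrade 0 \<and> g \<in> jgrade 0 \<and> f - g \<in> I'"
  morphisms rep_even even_coset
proof (intro part_equivpI sympI transpI)
  show "\<exists>f. f \<in> jgrade 0 \<and> f \<in> jgrade 0 \<and> f - f \<in> (I' :: 'k free_jordan set)"
    by (intro exI[of _ 0]) simp
next
  fix f g :: "'k free_jordan"
  assume *: "f \<in> jgrade 0 \<and> g \<in> jgrade 0 \<and> f - g \<in> I'"
  then show "g \<in> jgrade 0 \<and> f \<in> jgrade 0 \<and> g - f \<in> I'" using I'_closed(3)[of "f - g"] by simp
  fix h assume **: "g \<in> jgrade 0 \<and> h \<in> jgrade 0 \<and> g - h \<in> I'"
  then show "f \<in> jgrade 0 \<and> h \<in> jgrade 0 \<and> f - h \<in> I'"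
    using * I'_closed(2)[of "f - g" "g - h"] by simp
qed

quotient_type (overloaded) 'k odd_part = "'k::{field,finite} free_jordan" /
    partial: "\<lambda>f g. f \<in> jgrade 1 \<and> g \<in> jgrade 1 \<and> f - g \<in> I'"
  morphisms rep_odd odd_coset
proof (intro part_equivpI sympI transpI)
  show "\<exists>f. f \<in> jgrade 1 \<and> f \<in> jgrade 1 \<and> f - f \<in> (I' :: 'k free_jordan set)"
    by (intro exI[of _ 0]) simp
next
  fix f g :: "'k free_jordan"
  assume *: "f \<in> jgrade 1 \<and> g \<in> jgrade 1 \<and> f - g \<in> I'"
  then show "g \<in> jgrade 1 \<and> f \<in> jgrade 1 \<and> g - f \<in> I'" using I'_closed(3)[of "f - g"] by simp
  fix h assume **: "g \<in> jgrade 1 \<and> h \<in> jgrade 1 \<and> g - h \<in> I'"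
  then show "f \<in> jgrade 1 \<and> h \<in> jgrade 1 \<and> f - h \<in> I'"
    using * I'_closed(2)[of "f - g" "g - h"] by simp
qed

lemma even_coset_eq_iff:
  "f \<in> jgrade 0 \<Longrightarrow> g \<in> jgrade 0 \<Longrightarrow> even_coset f = even_coset g \<longleftrightarrow> f - g \<in> I'"
  using Quotient_rel[OF Quotient_even_part, of f g] by simp

lemma odd_coset_eq_iff:
  "f \<in> jgrade 1 \<Longrightarrow> g \<in> jgrade 1 \<Longrightarrow> odd_coset f = odd_coset g \<longleftrightarrow> f - g \<in> I'"
  using Quotient_rel[OF Quotient_odd_part, of f g] by simp

lemma even_part_cases [cases type: even_part]:
  obtains f where "u = even_coset f" "f \<in> jgrade 0"
  using Quotient_abs_rep[OF Quotient_even_part, of u] Quotient_rep_reflp[OF Quotient_even_part, of u]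
  by (intro that[of "rep_even u"]) simp_all

lemma odd_part_cases [cases type: odd_part]:
  obtains f where "x = odd_coset f" "f \<in> jgrade 1"
  using Quotient_abs_rep[OF Quotient_odd_part, of x] Quotient_rep_reflp[OF Quotient_odd_part, of x]
  by (intro that[of "rep_odd x"]) simp_all

instantiation even_part :: ("{field,finite}") "{zero,one,plus,minus,uminus,times}"
begin

lift_definition zero_even_part :: "'a even_part" is 0 by simp
lift_definition one_even_part :: "'a even_part" is 1 by simp
lift_definition plus_even_part :: "'a even_part \<Rightarrow> 'a even_part \<Rightarrow> 'a even_part" is "(+)"
  by (simp add: add_diff_add)
lift_definition uminus_even_part :: "'a even_part \<Rightarrow> 'a even_part" is uminus
  using I'_closed(3) by (fastforce simp: algebra_simps)
lift_definition minus_even_part :: "'a even_part \<Rightarrow> 'a even_part \<Rightarrow> 'a even_part" is "(-)"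
proof -
  fix f f' g g' :: "'a free_jordan"
  assume *: "f \<in> jgrade 0 \<and> f' \<in> jgrade 0 \<and> f - f' \<in> I'"
    "g \<in> jgrade 0 \<and> g' \<in> jgrade 0 \<and> g - g' \<in> I'"
  have "(f - g) - (f' - g') = (f - f') - (g - g')" by simp
  also have "\<dots> \<in> I'" by (rule I'_closed(4)) (use * in auto)
  finally show "f - g \<in> jgrade 0 \<and> f' - g' \<in> jgrade 0 \<and> (f - g) - (f' - g') \<in> I'"
    using * by simp
qed
lift_definition times_even_part :: "'a even_part \<Rightarrow> 'a even_part \<Rightarrow> 'a even_part" is "(*)"
  by (simp add: I'_mult_cong)

instance ..

end

lift_definition even_scale :: "'k::{field,finite} \<Rightarrow> 'k even_part \<Rightarrow> 'k even_part" is jscale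
  by (simp add: jord.scale_right_diff_distrib[symmetric])

lift_definition act :: "'k::{field,finite} even_part \<Rightarrow> 'k odd_part \<Rightarrow> 'k odd_part" is "(*)"
  by (simp add: I'_mult_cong)

lift_definition pair :: "'k::{field,finite} odd_part \<Rightarrow> 'k odd_part \<Rightarrow> 'k even_part" is "(*)"
  by (simp add: I'_mult_cong)

lemma coset_simps:
  "even_coset 0 = 0" "even_coset 1 = 1"
  "f \<in> jgrade 0 \<Longrightarrow> g \<in> jgrade 0 \<Longrightarrow> even_coset (f + g) = even_coset f + even_coset g"
  "f \<in> jgrade 0 \<Longrightarrow> g \<in> jgrade 0 \<Longrightarrow> even_coset (f - g) = even_coset f - even_coset g"
  "f \<in> jgrade 0 \<Longrightarrow> even_coset (- f) = - even_coset f"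
  "f \<in> jgrade 0 \<Longrightarrow> even_coset (jscale c f) = even_scale c (even_coset f)"
  "f \<in> jgrade 0 \<Longrightarrow> g \<in> jgrade 0 \<Longrightarrow> even_coset (f * g) = even_coset f * even_coset g"
  "f \<in> jgrade 0 \<Longrightarrow> h \<in> jgrade 1 \<Longrightarrow> odd_coset (f * h) = act (even_coset f) (odd_coset h)"
  "h \<in> jgrade 1 \<Longrightarrow> h' \<in> jgrade 1 \<Longrightarrow> even_coset (h * h') = pair (odd_coset h) (odd_coset h')"
  by (simp_all add: zero_even_part.abs_eq one_even_part.abs_eq plus_even_part.abs_eq
      minus_even_part.abs_eq uminus_even_part.abs_eq even_scale.abs_eq times_even_part.abs_eq
      act.abs_eq pair.abs_eq)

lemma even_coset_0_iff: "f \<in> jgrade 0 \<Longrightarrow> even_coset f = 0 \<longleftrightarrow> f \<in> I'"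
  using even_coset_eq_iff[of f 0] by (simp add: coset_simps)

instance even_part :: ("{field,finite}") "{comm_ring,comm_monoid_mult}"
proof
  fix a b c :: "'a even_part"
  obtain f g h where fgh: "f \<in> jgrade 0" "g \<in> jgrade 0" "h \<in> jgrade 0"
    and [simp]: "a = even_coset f" "b = even_coset g" "c = even_coset h"
    by (metis even_part_cases)
  note s = coset_simps[symmetric] fgh
  show "a + b + c = a + (b + c)" by (simp add: s add.assoc)
  show "a + b = b + a" by (simp add: s add.commute)
  show "0 + a = a" by (simp add: s)
  show "- a + a = 0" by (simp add: s)
  show "a - b = a + - b" by (simp add: s)
  show "a * b * c = a * (b * c)" by (simp add: s even_coset_eq_iff I'_identities(1))
  show "a * b = b * a" by (simp add: s free_jordan_laws(4)[of f])
  show "(a + b) * c = a * c + b * c" by (simp add: s free_jordan_distrib)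
  show "1 * a = a" by (simp add: s)
qed

lemma even_coset_lpow: "f \<in> jgrade 0 \<Longrightarrow> even_coset (lpow f n) = even_coset f ^ n"
  by (induction n) (simp_all add: coset_simps mult.commute)

lemma even_scale_simps:
  "even_scale c (u + v) = even_scale c u + even_scale c v"
  "even_scale (c + d) u = even_scale c u + even_scale d u"
  "even_scale c u * v = even_scale c (u * v)" "u * even_scale c v = even_scale c (u * v)"
  "even_scale 1 u = u" "even_scale 0 u = 0" "even_scale (-1) u = - u"
proof -
  obtain f g where fg: "f \<in> jgrade 0" "g \<in> jgrade 0"
    and [simp]: "u = even_coset f" "v = even_coset g"
    by (metis even_part_cases)
  note s = coset_simps[symmetric] fg
  show "even_scale c (u + v) = even_scale c u + even_scale c v"
    "even_scale (c + d) u = even_scale c u + even_scale d u"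
    "even_scale c u * v = even_scale c (u * v)" "u * even_scale c v = even_scale c (u * v)"
    "even_scale 1 u = u" "even_scale 0 u = 0" "even_scale (-1) u = - u"
    by (simp_all add: s jord.scale_left_distrib jord.scale_right_distrib)
qed

text \<open>Apart from the unit law and commutativity, each law is one of the associator generators
  read in cosets: with one odd entry it makes \<open>act\<close> an action, with two it makes even
  elements self-adjoint for \<open>pair\<close>, and the remaining two govern products of three and
  four odd elements.\<close>

lemma act_pair_laws:
  "act 1 x = x"
  "act (u * v) x = act u (act v x)"
  "pair x y = pair y x"
  "pair (act u x) y = pair x (act u y)"
  "act (pair x y) w = act (pair y w) x"
  "pair (act (pair x y) w) z = pair x y * pair w z"
proof -
  obtain f g where fg: "f \<in> jgrade 0" "g \<in> jgrade 0"
    and [simp]: "u = even_coset f" "v = even_coset g"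
    by (metis even_part_cases)
  obtain a b c d where abcd: "a \<in> jgrade 1" "b \<in> jgrade 1" "c \<in> jgrade 1" "d \<in> jgrade 1"
    and [simp]: "x = odd_coset a" "y = odd_coset b" "w = odd_coset c" "z = odd_coset d"
    by (metis odd_part_cases)
  note s = coset_simps[symmetric] fg abcd even_coset_eq_iff odd_coset_eq_iff
  note comm = free_jordan_laws(4)
  show "act 1 x = x" by (simp add: s)
  show "act (u * v) x = act u (act v x)"
  proof -
    have "(f * g) * a - f * (g * a) = - ((a * g) * f - a * (g * f))" by (simp add: comm)
    moreover have "(a * g) * f - a * (g * f) \<in> I'" using fg abcd by (intro I'_identities)
    ultimately have "(f * g) * a - f * (g * a) \<in> I'" by (simp only: I'_closed)
    then show ?thesis by (simp add: s)
  qed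
  show "pair x y = pair y x" by (simp add: s comm[of a b])
  show "pair (act u x) y = pair x (act u y)"
    using I'_identities(3)[OF abcd(1) fg(1) abcd(2)] by (simp add: s comm[of f a])
  show "act (pair x y) w = act (pair y w) x"
    using I'_identities(4)[OF abcd(1-3)] by (simp add: s comm[of "b * c"])
  show "pair (act (pair x y) w) z = pair x y * pair w z"
    by (simp add: s I'_identities)
qed

lemma act_card_power: "act (u ^ CARD('k)) x = act u x"
  for u :: "'k::{field,finite} even_part"
proof -
  obtain f a where *: "f \<in> jgrade 0" "a \<in> jgrade 1"
    and [simp]: "u = even_coset f" "x = odd_coset a"
    by (metis even_part_cases odd_part_cases)
  have "(lpow f CARD('k) - f) * a \<in> I'" using * by (rule I'_identities(8))
  then show ?thesis
    by (simp add: coset_simps[symmetric] even_coset_lpow[symmetric] * odd_coset_eq_iff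
        free_jordan_distrib)
qed

lemma card_power_diff_mult: "(u ^ CARD('k) - u) * (v ^ CARD('k) - v) = 0"
  for u v :: "'k::{field,finite} even_part"
proof -
  obtain f g where *: "f \<in> jgrade 0" "g \<in> jgrade 0"
    and [simp]: "u = even_coset f" "v = even_coset g"
    by (metis even_part_cases)
  have "(lpow f CARD('k) - f) * (lpow g CARD('k) - g) \<in> I'" using * by (rule I'_identities(6))
  then show ?thesis
    by (simp add: coset_simps(3-)[symmetric] even_coset_lpow[symmetric] * even_coset_0_iff)
qed

text \<open>The linearized Jordan identity for two even and two odd elements. By self-adjointness
  both mixed products on its right side equal \<open>pair (act (u * v) x) y\<close>, and one of them
  cancels against the same term on the left.\<close>

lemma pair_act_derivation:
  fixes u v :: "'k::{field,finite} even_part"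
  assumes "CHAR('k) \<noteq> 2"
  shows "pair (act (u * v) x) y + u * v * pair x y = u * pair (act v x) y + v * pair (act u x) y"
proof -
  obtain f g where fg: "f \<in> jgrade 0" "g \<in> jgrade 0"
    and [simp]: "u = even_coset f" "v = even_coset g"
    by (metis even_part_cases)
  obtain a b where ab: "a \<in> jgrade 1" "b \<in> jgrade 1"
    and [simp]: "x = odd_coset a" "y = odd_coset b"
    by (metis odd_part_cases)
  have "even_coset (((f * g) * b) * a + ((f * a) * b) * g + ((g * a) * b) * f)
      = even_coset ((f * g) * (b * a) + (f * a) * (b * g) + (g * a) * (b * f))"
    by (simp only: jordan_linearized[OF assms])
  then have "pair (act (u * v) y) x + pair (act u x) y * v + pair (act v x) y * u
      = u * v * pair y x + pair (act u x) (act v y) + pair (act v x) (act u y)"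
    by (simp add: coset_simps fg ab free_jordan_laws(4)[of b f] free_jordan_laws(4)[of b g])
  moreover have "pair (act u x) (act v y) = pair (act (u * v) x) y"
    by (simp only: mult.commute[of u v] act_pair_laws(2) act_pair_laws(4)[symmetric])
  moreover have "pair (act v x) (act u y) = pair (act (u * v) x) y"
    by (simp add: act_pair_laws(2) act_pair_laws(4)[symmetric])
  moreover have "pair (act (u * v) y) x = pair (act (u * v) x) y"
    by (simp only: act_pair_laws(3)[of _ x] act_pair_laws(4))
  ultimately show ?thesis
    by (simp add: act_pair_laws(3)[of "odd_coset b"] algebra_simps)
qed

text \<open>
  By the previous identity \<open>u \<mapsto> u * pair x y - pair (act u x) y\<close> is a derivation, so it kills
  \<open>q\<close>-th powers; and \<open>u\<close> and \<open>u ^ q\<close> act in the same way.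
\<close>

lemma pair_act:
  fixes u :: "'k::{field,finite} even_part"
  assumes char: "CHAR('k) \<noteq> 2"
  shows "pair (act u x) y = u ^ CARD('k) * pair x y"
proof -
  let ?B = "\<lambda>u. pair (act u x) y"
  \<comment> \<open>The power rule for the derivation, rearranged so that no subtraction occurs;
    \<open>even_scale\<close> supplies the integer multiples.\<close>
  have pow: "?B (u ^ Suc n) + even_scale (of_nat n) (u ^ Suc n * pair x y)
      = even_scale (of_nat (Suc n)) (u ^ n * ?B u)" for n
  proof (induction n)
    case (Suc n)
    have sc: "even_scale (of_nat (Suc m)) w = even_scale (of_nat m) w + w" for m and w :: "'k even_part"
      by (simp add: even_scale_simps add.commute)
    let ?s = "u ^ Suc (Suc n) * pair x y" and ?w = "u ^ Suc n * ?B u"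
    have P: "?B (u ^ Suc (Suc n)) + ?s = u * ?B (u ^ Suc n) + ?w"
      using pair_act_derivation[OF char, of u "u ^ Suc n" x y] by simp
    have Q: "u * ?B (u ^ Suc n) + even_scale (of_nat n) ?s = even_scale (of_nat (Suc n)) ?w"
      using arg_cong[OF Suc, of "(*) u"] by (simp add: even_scale_simps algebra_simps)
    have "?B (u ^ Suc (Suc n)) + even_scale (of_nat (Suc n)) ?s
        = (?B (u ^ Suc (Suc n)) + ?s) + even_scale (of_nat n) ?s"
      by (simp only: sc add_ac)
    also have "\<dots> = (u * ?B (u ^ Suc n) + even_scale (of_nat n) ?s) + ?w"
      unfolding P by (simp only: add_ac)
    also have "\<dots> = even_scale (of_nat (Suc (Suc n))) ?w"
      unfolding Q by (rule sc[symmetric])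
    finally show ?case .
  qed (simp add: even_scale_simps)
  obtain n where n: "CARD('k) = Suc n"
    using finite_UNIV_card_ge_0[where ?'a = 'k] gr0_conv_Suc by auto
  \<comment> \<open>At the exponent \<open>Suc n = q\<close> the right side of the power rule
    vanishes, and the multiple \<open>n\<close> on the left becomes -1.\<close>
  then have "of_nat n = (-1 :: 'k)"
    using of_nat_card_eq_0[where ?'k = 'k] by (simp add: eq_neg_iff_add_eq_0 add.commute)
  moreover have "of_nat (Suc n) = (0 :: 'k)" using of_nat_card_eq_0 n by metis
  ultimately have "?B (u ^ CARD('k)) = u ^ CARD('k) * pair x y"
    using pow[of n] by (simp only: n even_scale_simps) simp
  then show ?thesis by (simp only: act_card_power)
qed

subsection \<open>Monomials spanning the quotient\<close>

definition yword :: "nat list \<Rightarrow> 'k::field free_jordan"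
  where "yword xs = foldr (\<lambda>i u. yv i * u) xs 1"

definition zword :: "nat list \<Rightarrow> 'k::field free_jordan"
  where "zword xs = foldr (\<lambda>i u. zv i * u) xs 1"

lemma yword_simps [simp]: "yword [] = 1" "yword (i # xs) = yv i * yword xs"
  by (simp_all add: yword_def)

lemma zword_simps [simp]: "zword [] = 1" "zword (i # xs) = zv i * zword xs"
  by (simp_all add: zword_def)

lemma zword_replicate: "zword (replicate n i) = lpow (zv i) n"
  by (induction n) (simp_all add: free_jordan_laws(4)[of _ "zv i"])

lemma yword_jgrade [simp]: "yword xs \<in> jgrade 0"
  by (induction xs) simp_all

lemma zword_jgrade:
  "even (length xs) \<Longrightarrow> (zword xs :: 'k::field free_jordan) \<in> jgrade 0"
  "odd (length xs) \<Longrightarrow> (zword xs :: 'k free_jordan) \<in> jgrade 1"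
  by (induction xs) simp_all

lemma coset_eq_even: "f \<in> jgrade 0 \<Longrightarrow> g \<in> jgrade 0 \<Longrightarrow> even_coset f = even_coset g \<Longrightarrow> coset f = coset g"
  by (simp add: coset_eq_iff even_coset_eq_iff)

lemma coset_eq_odd: "f \<in> jgrade 1 \<Longrightarrow> g \<in> jgrade 1 \<Longrightarrow> odd_coset f = odd_coset g \<Longrightarrow> coset f = coset g"
  by (simp add: coset_eq_iff odd_coset_eq_iff)

lemma coset_mult_cong: "coset f = coset f' \<Longrightarrow> coset g = coset g' \<Longrightarrow> coset (f * g) = coset (f' * g')"
  unfolding coset_eq_iff by (rule I'_mult_cong)

abbreviation yprod :: "nat multiset \<Rightarrow> 'k::{field,finite} even_part"
  where "yprod M \<equiv> \<Prod>\<^sub># (image_mset (\<lambda>i. even_coset (yv i)) M)"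

lemma even_coset_yword: "even_coset (yword xs) = yprod (mset xs)"
  by (induction xs) (simp_all add: coset_simps)

lemma zword_coset_Cons:
  "even (length xs) \<Longrightarrow> odd_coset (zword (i # xs) :: 'k::{field,finite} free_jordan) = act (even_coset (zword xs)) (odd_coset (zv i))"
  "odd (length xs) \<Longrightarrow> even_coset (zword (i # xs) :: 'k free_jordan) = pair (odd_coset (zv i)) (odd_coset (zword xs))"
  by (simp_all add: coset_simps zword_jgrade free_jordan_laws(4)[of "zv i"] act_pair_laws(3))

text \<open>Unlike in \<open>pair_act\<close>, no q-th power appears: a nonempty even word is itself
  a product of two odd elements, so the last law of \<open>act_pair_laws\<close> lets it leave the
  pairing unchanged.\<close>

lemma pair_act_zword:
  assumes "even (length xs)"
  shows "pair (act (even_coset (zword xs)) x) y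
    = even_coset (zword xs :: 'k::{field,finite} free_jordan) * pair x y"
proof (cases xs)
  case Nil
  then show ?thesis by (simp add: coset_simps act_pair_laws)
next
  case (Cons i ys)
  with assms show ?thesis using zword_coset_Cons(2)[of ys i, where ?'k = 'k]
    by (simp add: act_pair_laws(6) del: zword_simps)
qed

text \<open>This is independence of bracketing for products of odd variables. The four parities are
  treated together because prepending a letter switches the parity of \<open>xs\<close>.\<close>

lemma zword_append_parity:
  fixes xs ys :: "nat list"
  defines "E' \<equiv> \<lambda>xs. even_coset (zword xs) :: 'k::{field,finite} even_part"
    and "O' \<equiv> \<lambda>xs. odd_coset (zword xs) :: 'k odd_part"
  shows "(even (length xs) \<and> even (length ys) \<longrightarrow> E' (xs @ ys) = E' xs * E' ys) \<and>
    (even (length xs) \<and> odd (length ys) \<longrightarrow> O' (xs @ ys) = act (E' xs) (O' ys)) \<and>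
    (odd (length xs) \<and> even (length ys) \<longrightarrow> O' (xs @ ys) = act (E' ys) (O' xs)) \<and>
    (odd (length xs) \<and> odd (length ys) \<longrightarrow> E' (xs @ ys) = pair (O' xs) (O' ys))"
proof (induction xs)
  case Nil
  show ?case by (simp add: E'_def coset_simps act_pair_laws(1))
next
  case (Cons i xs)
  define z where "z = (odd_coset (zv i) :: 'k odd_part)"
  have c: "even (length xs) \<Longrightarrow> O' (i # xs) = act (E' xs) z"
    "odd (length xs) \<Longrightarrow> E' (i # xs) = pair z (O' xs)" for xs
    unfolding E'_def O'_def z_def by (fact zword_coset_Cons)+
  have p: "even (length ys) \<Longrightarrow> pair (act (E' ys) x) y = E' ys * pair x y" for x y
    unfolding E'_def by (rule pair_act_zword)
  consider "even (length xs)" "even (length ys)" | "even (length xs)" "odd (length ys)"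
    | "odd (length xs)" "even (length ys)" | "odd (length xs)" "odd (length ys)" by blast
  then show ?case
  proof cases
    case 1
    with Cons.IH have "E' (xs @ ys) = E' ys * E' xs" by (simp add: mult.commute)
    with 1 show ?thesis by (simp add: c act_pair_laws(2))
  next
    case 2
    with Cons.IH have "O' (xs @ ys) = act (E' xs) (O' ys)" by simp
    with 2 show ?thesis by (simp add: c act_pair_laws(4))
  next
    case 3
    with Cons.IH have "O' (xs @ ys) = act (E' ys) (O' xs)" by simp
    with 3 show ?thesis
      by (simp add: c act_pair_laws(4)[symmetric] p mult.commute)
  next
    case 4
    with Cons.IH have "E' (xs @ ys) = pair (O' xs) (O' ys)" by simp
    with 4 show ?thesis by (simp add: c act_pair_laws(5)[of z])
  qed
qed

lemma coset_zword_append: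
  "coset (zword (xs @ ys) :: 'k::{field,finite} free_jordan) = coset (zword xs * zword ys)"
proof -
  note p = zword_append_parity[of xs ys, where ?'k = 'k]
  note comm = free_jordan_laws(4)[of "zword xs :: 'k free_jordan" "zword ys"]
  consider "even (length xs)" "even (length ys)" | "even (length xs)" "odd (length ys)"
    | "odd (length xs)" "even (length ys)" | "odd (length xs)" "odd (length ys)" by blast
  then show ?thesis
  proof cases
    case 1
    with p show ?thesis by (intro coset_eq_even) (simp_all add: zword_jgrade coset_simps)
  next
    case 2
    with p show ?thesis by (intro coset_eq_odd) (simp_all add: zword_jgrade coset_simps)
  next
    case 3
    with p show ?thesis unfolding comm
      by (intro coset_eq_odd) (simp_all add: zword_jgrade coset_simps)
  next
    case 4
    with p show ?thesis by (intro coset_eq_even) (simp_all add: zword_jgrade coset_simps)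
  qed
qed

text \<open>Commutativity of the product only rotates a word. Rotating a chosen letter to the front
  and permuting the rest by induction reaches every rearrangement.\<close>

lemma coset_zword_cong:
  "mset xs = mset ys \<Longrightarrow> coset (zword xs :: 'k::{field,finite} free_jordan) = coset (zword ys)"
proof (induction xs arbitrary: ys)
  case (Cons x xs)
  have swap: "coset (zword (a @ b) :: 'k free_jordan) = coset (zword (b @ a))" for a b
    by (simp only: coset_zword_append free_jordan_laws(4)[of "zword a"])
  have "x \<in> set ys" using Cons.prems by (metis list.set_intros(1) set_mset_mset)
  then obtain a b where ys: "ys = a @ x # b" by (meson split_list)
  then have "coset (zword xs :: 'k free_jordan) = coset (zword (b @ a))"
    using Cons.prems by (intro Cons.IH) simp
  then have "coset (zword (x # xs) :: 'k free_jordan) = coset (zword (x # b @ a))"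
    unfolding zword_simps by (rule coset_mult_cong[OF refl])
  also have "\<dots> = coset (zword ys)" using swap[of "x # b" a] by (simp add: ys)
  finally show ?case .
qed simp

lemma coset_yword_cong:
  "mset xs = mset ys \<Longrightarrow> coset (yword xs :: 'k::{field,finite} free_jordan) = coset (yword ys)"
  by (rule coset_eq_even) (simp_all add: even_coset_yword)

definition yzmon :: "nat multiset \<Rightarrow> nat multiset \<Rightarrow> 'k::field free_jordan"
  where "yzmon M N = yword (sorted_list_of_multiset M) * zword (sorted_list_of_multiset N)"

lemma coset_yzmon:
  "mset xs = M \<Longrightarrow> mset ys = N \<Longrightarrow> coset (yzmon M N :: 'k::{field,finite} free_jordan) = coset (yword xs * zword ys)"
  unfolding yzmon_def by (intro coset_mult_cong coset_yword_cong coset_zword_cong) simp_all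

definition zlist :: "nat multiset \<Rightarrow> 'k::field free_jordan"
  where "zlist N = zword (sorted_list_of_multiset N)"

lemma length_sorted_list_of_multiset [simp]: "length (sorted_list_of_multiset M) = size M"
  by (metis mset_sorted_list_of_multiset size_mset)

lemma yzmon_jgrade:
  "even (size N) \<Longrightarrow> yzmon M N \<in> jgrade 0" "odd (size N) \<Longrightarrow> yzmon M N \<in> jgrade 1"
  by (simp_all add: yzmon_def zword_jgrade)

lemma even_coset_yzmon:
  "even (size N) \<Longrightarrow> even_coset (yzmon M N) = yprod M * even_coset (zlist N)"
  by (simp add: yzmon_def zlist_def coset_simps zword_jgrade even_coset_yword)

lemma odd_coset_yzmon:
  "odd (size N) \<Longrightarrow> odd_coset (yzmon M N) = act (yprod M) (odd_coset (zlist N))"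
  by (simp add: yzmon_def zlist_def coset_simps zword_jgrade even_coset_yword)

lemma coset_words_mult:
  fixes a b a' b' :: "nat list"
  assumes char: "CHAR('k::{field,finite}) \<noteq> 2"
  obtains c d where "coset ((yword a * zword b) * (yword a' * zword b') :: 'k free_jordan)
    = coset (yword c * zword d)"
proof -
  have even_any: "coset ((yword a * zword b) * (yword a' * zword b') :: 'k free_jordan)
    = coset (yword (a @ a') * zword (b @ b'))" if b: "even (length b)" for a b a' b' :: "nat list"
  proof (cases "even (length b')")
    case True
    with b show ?thesis using zword_append_parity[of b b', where ?'k = 'k]
      by (intro coset_eq_even)
        (simp_all add: coset_simps zword_jgrade even_coset_yword mult_ac)
  next
    case False
    with b show ?thesis using zword_append_parity[of b b', where ?'k = 'k]
      by (intro coset_eq_odd)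
        (simp_all add: coset_simps zword_jgrade even_coset_yword act_pair_laws(2)[symmetric] mult_ac)
  qed
  consider "even (length b)" | "even (length b')" | "odd (length b)" "odd (length b')" by blast
  then show ?thesis
  proof cases
    case 1
    then show ?thesis by (rule that[OF even_any])
  next
    case 2
    show ?thesis
      by (rule that[of "a' @ a" "b' @ b"])
        (simp only: free_jordan_laws(4)[of "yword a * zword b"] even_any[OF 2])
  next
    case 3
    \<comment> \<open>With two odd factors the even letters end up inside a pairing, and
      \<open>pair_act\<close> releases them with all exponents multiplied by q; hence the q-fold
      repetition.\<close>
    let ?c = "concat (replicate CARD('k) (a @ a'))"
    have c: "even_coset (yword (concat (replicate n (a @ a')))) = (yprod (mset a) * yprod (mset a')) ^ n" for n
      by (induction n) (simp_all add: even_coset_yword coset_simps mult.assoc)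
    have "pair (act (yprod (mset a)) (odd_coset (zword b :: 'k free_jordan))) (act (yprod (mset a')) (odd_coset (zword b')))
      = (yprod (mset a) * yprod (mset a')) ^ CARD('k) * pair (odd_coset (zword b)) (odd_coset (zword b'))"
      (is "pair (act ?u ?x) (act ?v ?y) = _")
    proof -
      have "pair (act ?u ?x) (act ?v ?y) = pair (act (?v * ?u) ?x) ?y"
        by (simp only: act_pair_laws(2) act_pair_laws(4)[symmetric])
      also have "\<dots> = (?v * ?u) ^ CARD('k) * pair ?x ?y" by (rule pair_act[OF char])
      finally show ?thesis by (simp only: mult.commute[of ?v])
    qed
    then show ?thesis
      using 3 zword_append_parity[of b b', where ?'k = 'k]
      by (intro that[of ?c "b @ b'"] coset_eq_even)
        (simp_all add: coset_simps zword_jgrade c even_coset_yword[of a] even_coset_yword[of a'])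
  qed
qed

text \<open>With \<open>I'\<close> among the spanning elements, congruence modulo \<open>I'\<close>
  becomes membership in the span. The span contains the variables and is closed under products,
  because a product of two monomials is again congruent to a monomial.\<close>

lemma span_words_eq_UNIV:
  assumes char: "CHAR('k::{field,finite}) \<noteq> 2"
  shows "jord.span (range (case_prod yzmon) \<union> I') = (UNIV :: 'k free_jordan set)"
proof -
  let ?A = "range (case_prod yzmon) \<union> (I' :: 'k free_jordan set)"
  have word: "f \<in> jord.span ?A" if "coset f = coset (yword a * zword b)" for f a b
  proof -
    have "f - yzmon (mset a) (mset b) \<in> I'"
      using that coset_yzmon[OF refl refl, of a b, where ?'k = 'k] by (simp add: coset_eq_iff[symmetric])
    moreover have "yzmon (mset a) (mset b) \<in> ?A" by force
    ultimately have "(f - yzmon (mset a) (mset b)) + yzmon (mset a) (mset b) \<in> jord.span ?A"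
      by (intro jord.span_add jord.span_base) auto
    then show ?thesis by simp
  qed
  have closed: "u * v \<in> jord.span ?A" if uv: "u \<in> ?A" "v \<in> ?A" for u v
  proof (cases "u \<in> I' \<or> v \<in> I'")
    case True
    then show ?thesis by (auto intro!: jord.span_base)
  next
    case False
    with uv obtain M N M' N' where *: "u = yzmon M N" "v = yzmon M' N'" by auto
    show ?thesis unfolding *
      by (rule coset_words_mult[OF char]) (rule word, simp only: yzmon_def)
  qed
  have "f \<in> jord.span ?A" for f
  proof (induction f rule: free_jordan_induct)
    case (var v)
    show ?case
    proof (cases v)
      case (YVar i)
      then show ?thesis using word[of "yv i" "[i]" "[]"] by simp
    next
      case (ZVar i)
      then show ?thesis using word[of "zv i" "[]" "[i]"] by simp
    qed
  next
    case one
    show ?case using word[of 1 "[]" "[]"] by simp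
  next
    case (mult a b)
    then show ?case using span_mult_closed[of ?A ?A ?A a b] closed by blast
  qed (auto intro: jord.span_add jord.span_scale)
  then show ?thesis by blast
qed

text \<open>
  The pairs of exponents of the normal forms. Since \<open>y\<^sub>i ^ q\<close> evaluates to a scalar, form (d) represents
  the same coset as the normal form whose \<open>y\<^sub>i\<close>-exponent is larger by \<open>q\<close>.
\<close>

definition reduced :: "nat \<Rightarrow> (nat multiset \<times> nat multiset) set"
  where "reduced q = {(M, N). (\<forall>i. count N i < q) \<and> (\<forall>i. count M i < 2 * q) \<and>
    (\<forall>i j. i \<noteq> j \<longrightarrow> q \<le> count M i \<longrightarrow> count M j < q) \<and> (odd (size N) \<longrightarrow> (\<forall>i. count M i < q))}"

text \<open>Every reduction replaces blocks of q equal letters by single letters. This shortens the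
  monomial, so induction on its length terminates the rewriting.\<close>

lemma yzmon_in_span_reduced:
  assumes char: "CHAR('k::{field,finite}) \<noteq> 2"
  shows "(yzmon M N :: 'k free_jordan) \<in> jord.span (case_prod yzmon ` reduced CARD('k) \<union> I')"
    (is "_ \<in> ?S")
proof (induction "size M + size N" arbitrary: M N rule: less_induct)
  case less
  let ?q = "CARD('k)"
  have q: "?q \<ge> 3" by (rule card_field_ge_3[OF char])
  have sub: "f \<in> ?S" if "g \<in> ?S" "f - g \<in> I'" for f g :: "'k free_jordan"
  proof -
    have "(f - g) + g \<in> ?S" using that by (intro jord.span_add) (auto intro: jord.span_base)
    then show ?thesis by simp
  qed
  consider i where "?q \<le> count N i"
    | i where "odd (size N)" "?q \<le> count M i"
    | i j M' where "even (size N)" "M = M' + replicate_mset ?q i + replicate_mset ?q j"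
    | "(M, N) \<in> reduced ?q"
  proof (cases "(M, N) \<in> reduced ?q")
    case False
    note cases = that
    \<comment> \<open>An exponent of at least 2q and two distinct exponents of at least q both
      exhibit two blocks of q letters, with \<open>i = j\<close> in the first situation. If the
      number of odd letters is odd, one block already suffices.\<close>
    have double: thesis if M: "M = M' + replicate_mset ?q i + replicate_mset ?q j" for M' i j
    proof (cases "even (size N)")
      case True
      then show thesis using M by (rule cases(3))
    next
      case False
      moreover have "?q \<le> count M i" by (subst M) simp
      ultimately show thesis by (rule cases(2))
    qed
    from False consider i where "?q \<le> count N i"
      | i where "odd (size N)" "?q \<le> count M i"
      | i where "2 * ?q \<le> count M i"
      | i j where "i \<noteq> j" "?q \<le> count M i" "?q \<le> count M j"
      by (auto simp: reduced_def not_less)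
    then show thesis
    proof cases
      case (3 i)
      then have "M = M - replicate_mset (2 * ?q) i + replicate_mset ?q i + replicate_mset ?q i"
        by (simp add: multiset_eq_iff)
      then show thesis by (rule double)
    next
      case (4 i j)
      then have "M = M - replicate_mset ?q i - replicate_mset ?q j + replicate_mset ?q i + replicate_mset ?q j"
        by (simp add: multiset_eq_iff)
      then show thesis by (rule double)
    qed (use that in blast)+
  qed (use that in blast)
  then show ?case
  proof cases
    case (1 i)
    define N' where "N' = N - replicate_mset ?q i"
    have N: "N = N' + replicate_mset ?q i"
      unfolding N'_def using 1 by (rule replicate_subset_mset)
    let ?xs = "sorted_list_of_multiset M" and ?ys = "sorted_list_of_multiset N'"
    have "coset (zword (replicate ?q i) :: 'k free_jordan) = coset (zv i)"
      by (simp add: zword_replicate coset_eq_iff I'_identities(7))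
    then have "coset (zword (replicate ?q i @ ?ys) :: 'k free_jordan) = coset (zword (i # ?ys))"
      unfolding coset_zword_append zword_simps by (rule coset_mult_cong[OF _ refl])
    then have "coset (yword ?xs * zword (replicate ?q i @ ?ys) :: 'k free_jordan)
        = coset (yword ?xs * zword (i # ?ys))"
      by (rule coset_mult_cong[OF refl])
    then have "coset (yzmon M N :: 'k free_jordan) = coset (yzmon M (add_mset i N'))"
      using coset_yzmon[of ?xs M "replicate ?q i @ ?ys" N, where ?'k = 'k]
        coset_yzmon[of ?xs M "i # ?ys" "add_mset i N'", where ?'k = 'k]
      by (simp add: N)
    moreover have "yzmon M (add_mset i N') \<in> ?S"
      using q by (intro less) (simp add: N)
    ultimately show ?thesis using sub by (simp add: coset_eq_iff)
  next
    case (2 i)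
    define M' where "M' = M - replicate_mset ?q i"
    have M: "M = M' + replicate_mset ?q i"
      unfolding M'_def using 2(2) by (rule replicate_subset_mset)
    have "odd_coset (yzmon M N :: 'k free_jordan) = odd_coset (yzmon (add_mset i M') N)"
      using 2(1) by (simp add: odd_coset_yzmon M act_pair_laws(2) act_card_power mult.commute[of _ "yprod M'"]
          flip: act_pair_laws(2)) (simp add: act_pair_laws(2) act_card_power)
    then have "yzmon M N - yzmon (add_mset i M') N \<in> (I' :: 'k free_jordan set)"
      using 2(1) by (simp add: odd_coset_eq_iff yzmon_jgrade)
    moreover have "yzmon (add_mset i M') N \<in> ?S"
      using q by (intro less) (simp add: M)
    ultimately show ?thesis using sub by blast
  next
    case (3 i j M')
    let ?g = "yzmon (add_mset j (M' + replicate_mset ?q i)) N + yzmon (add_mset i (M' + replicate_mset ?q j)) N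
      - yzmon (add_mset i (add_mset j M')) N :: 'k free_jordan"
    define u v where "u = even_coset (yv i :: 'k free_jordan)" and "v = even_coset (yv j :: 'k free_jordan)"
    define w where "w = yprod M' * even_coset (zlist N :: 'k free_jordan)"
    \<comment> \<open>Expanding this product and solving for the longest term gives the combination
      \<open>?g\<close> of three shorter monomials.\<close>
    have "(u ^ ?q - u) * (v ^ ?q - v) * w = 0"
      by (simp add: card_power_diff_mult)
    then have "even_coset (yzmon M N :: 'k free_jordan) = even_coset ?g"
      using 3(1) by (simp add: even_coset_yzmon 3(2) coset_simps yzmon_jgrade
          u_def[symmetric] v_def[symmetric] w_def algebra_simps)
    then have "yzmon M N - ?g \<in> I'"
      using 3(1) by (simp add: even_coset_eq_iff yzmon_jgrade)
    moreover have "?g \<in> ?S"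
      using q by (intro jord.span_add jord.span_diff less) (simp_all add: 3(2))
    ultimately show ?thesis using sub by blast
  next
    case 4
    then show ?thesis by (intro jord.span_base) auto
  qed
qed

subsection \<open>Evaluation in \<open>UJ2\<close>\<close>

definition Mx :: "'k::field \<Rightarrow> 'k \<Rightarrow> 'k \<Rightarrow> 'k^2^2"
  where "Mx p e h = mscale p (mat 1) + mscale e (E 1 2) + mscale h (E 1 1 - E 2 2)"

lemma Mx_nth [simp]:
  "Mx p e h $ 1 $ 1 = p + h" "Mx p e h $ 1 $ 2 = e" "Mx p e h $ 2 $ 1 = 0" "Mx p e h $ 2 $ 2 = p - h"
  by (simp_all add: Mx_def mscale_def E_def axis_def mat_def)

lemma Mx_simps:
  "Mx p e h + Mx p' e' h' = Mx (p + p') (e + e') (h + h')"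
  "Mx p e h - Mx p' e' h' = Mx (p - p') (e - e') (h - h')"
  "mscale c (Mx p e h) = Mx (c * p) (c * e) (c * h)"
  "Mx 0 0 0 = 0" "mat 1 = Mx 1 0 0"
  by (auto simp: vec_eq_iff forall_2 mscale_def mat_def algebra_simps)

lemma jmul_Mx:
  fixes p :: "'k::field"
  assumes "CHAR('k) \<noteq> 2"
  shows "jmul (Mx p e h) (Mx p' e' h') = Mx (p * p' + h * h') (p * e' + e * p') (p * h' + h * p')"
  using two_neq_0[OF assms]
  by (simp add: jmul_def vec_eq_iff forall_2 mscale_def matrix_matrix_mult_def sum_2 field_simps)

lemma jmul_zero: "jmul 0 A = 0" "jmul A 0 = 0"
  by (simp_all add: jmul_def)

lemma Mx_eq_0_iff:
  fixes p :: "'k::field"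
  assumes "CHAR('k) \<noteq> 2"
  shows "Mx p e h = 0 \<longleftrightarrow> p = 0 \<and> e = 0 \<and> h = 0"
proof
  assume *: "Mx p e h = 0"
  have "Mx p e h $ 1 $ 1 = 0" "Mx p e h $ 2 $ 2 = 0" "Mx p e h $ 1 $ 2 = 0" by (simp_all add: *)
  then have ph: "p + h = 0" "p - h = 0" and "e = 0" by simp_all
  have "2 * p = (p + h) + (p - h)" "2 * h = (p + h) - (p - h)" by simp_all
  then have "2 * p = 0" "2 * h = 0" unfolding ph by simp_all
  with two_neq_0[OF assms] \<open>e = 0\<close> show "p = 0 \<and> e = 0 \<and> h = 0" by auto
qed (simp add: Mx_simps)

lemma UJ2_ass_grade_0: "A \<in> UJ2_ass_grade 0 \<longleftrightarrow> (\<exists>p e. A = Mx p e 0)"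
proof -
  have *: "mscale p (E 1 1 + E 2 2) + mscale e (E 1 2) = Mx p e 0" for p e :: 'a
    by (auto simp: vec_eq_iff forall_2 mscale_def E_def axis_def)
  have "A \<in> UJ2_ass_grade 0 \<longleftrightarrow>
      (\<exists>p. A - mscale p (E 1 1 + E 2 2) \<in> range (\<lambda>e. mscale e (E 1 2)))"
    by (simp add: UJ2_ass_grade_def mats.span_insert mats.span_singleton image_iff)
  also have "\<dots> \<longleftrightarrow> (\<exists>p e. A = Mx p e 0)"
    by (simp only: image_iff diff_eq_eq *[symmetric] add.commute UNIV_I bex_simps simp_thms)
  finally show ?thesis .
qed

lemma UJ2_ass_grade_1: "A \<in> UJ2_ass_grade 1 \<longleftrightarrow> (\<exists>h. A = Mx 0 0 h)"
proof -
  have *: "mscale h (E 1 1 - E 2 2) = Mx 0 0 h" for h :: 'a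
    by (auto simp: vec_eq_iff forall_2 mscale_def E_def axis_def)
  show ?thesis
    unfolding UJ2_ass_grade_def by (auto simp: mats.span_singleton *)
qed

lemma jmul_ass_grade:
  fixes A B :: "'k::field^2^2"
  assumes "CHAR('k) \<noteq> 2" "A \<in> UJ2_ass_grade d" "B \<in> UJ2_ass_grade e"
  shows "jmul A B \<in> UJ2_ass_grade (d + e)"
proof -
  have two: "(1 + 1 :: 2) = 0" by simp
  have "d = 0 \<or> d = 1" "e = 0 \<or> e = 1" using exhaust_2[of d] exhaust_2[of e] by auto
  then show ?thesis using assms(2,3)
    by (auto simp: UJ2_ass_grade_0 UJ2_ass_grade_1 jmul_Mx[OF assms(1)] two simp del: one_add_one)
      (intro exI, rule refl)+
qed

section \<open>Graded substitutions and their kernels\<close>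

lemma ass_substD:
  assumes "ass_subst \<phi>"
  shows "\<phi> 0 = 0" "\<phi> (f + g) = \<phi> f + \<phi> g" "\<phi> (f - g) = \<phi> f - \<phi> g" "\<phi> (- f) = - \<phi> f"
    "\<phi> (jscale c f) = mscale c (\<phi> f)" "\<phi> (sum F A) = (\<Sum>s\<in>A. \<phi> (F s))"
    "\<phi> (f * g) = jmul (\<phi> f) (\<phi> g)" "\<phi> 1 = Mx 1 0 0"
proof -
  interpret Vector_Spaces.linear jscale mscale \<phi> using assms by (simp add: ass_subst_def)
  show "\<phi> 0 = 0" "\<phi> (f + g) = \<phi> f + \<phi> g" "\<phi> (f - g) = \<phi> f - \<phi> g" "\<phi> (- f) = - \<phi> f"
    "\<phi> (jscale c f) = mscale c (\<phi> f)" "\<phi> (sum F A) = (\<Sum>s\<in>A. \<phi> (F s))"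
    by (simp_all add: zero add diff neg scale sum)
  show "\<phi> (f * g) = jmul (\<phi> f) (\<phi> g)" "\<phi> 1 = Mx 1 0 0"
    using assms by (simp_all add: ass_subst_def Mx_simps)
qed

lemma ass_subst_grade:
  fixes \<phi> :: "'k::field free_jordan \<Rightarrow> 'k^2^2"
  assumes "CHAR('k) \<noteq> 2" "ass_subst \<phi>" "f \<in> jgrade d"
  shows "\<phi> f \<in> UJ2_ass_grade d"
proof -
  have mon: "\<phi> u \<in> UJ2_ass_grade d" if "jmonomial d u" for u d
    using that
  proof (induction rule: jmonomial.induct)
    case 1
    show ?case by (auto simp: ass_substD[OF assms(2)] UJ2_ass_grade_0)
  next
    case (4 d u e v)
    then show ?case by (simp add: ass_substD[OF assms(2)] jmul_ass_grade[OF assms(1)])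
  qed (use assms(2) in \<open>auto simp: ass_subst_def\<close>)
  have sub: "mats.subspace (UJ2_ass_grade d :: ('k^2^2) set)"
    by (simp add: UJ2_ass_grade_def)
  show ?thesis using assms(3)[unfolded jgrade_def]
    by (induction rule: jord.span_induct_alt)
      (auto simp: ass_substD[OF assms(2)] mon
        intro!: mats.subspace_0[OF sub] mats.subspace_add[OF sub] mats.subspace_scale[OF sub])
qed

lemma ass_subst_var_cases:
  assumes "ass_subst \<phi>"
  obtains a b c where "\<And>i. \<phi> (yv i) = Mx (a i) (b i) 0" "\<And>i. \<phi> (zv i) = Mx 0 0 (c i)"
proof -
  have "\<exists>p e. \<phi> (yv i) = Mx p e 0" "\<exists>h. \<phi> (zv i) = Mx 0 0 h" for i
    using assms unfolding UJ2_ass_grade_0[symmetric] UJ2_ass_grade_1[symmetric] ass_subst_def by blast+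
  then show ?thesis using that by metis
qed

lemma ass_subst_ex:
  fixes a b c :: "nat \<Rightarrow> 'k::field"
  assumes "CHAR('k) \<noteq> 2"
  obtains \<phi> where "ass_subst \<phi>" "\<And>i. \<phi> (yv i) = Mx (a i) (b i) 0" "\<And>i. \<phi> (zv i) = Mx 0 0 (c i)"
proof -
  have "\<exists>!\<phi>. ass_subst \<phi> \<and> (\<forall>i. \<phi> (yv i) = Mx (a i) (b i) 0 \<and> \<phi> (zv i) = Mx 0 0 (c i))"
    by (rule ex1_ass_subst[OF assms]) (auto simp: UJ2_ass_grade_0 UJ2_ass_grade_1)
  then show ?thesis using that by blast
qed

text \<open>A substitution composed with a graded endomorphism is again a substitution, because
  substitutions map each degree of the free algebra into the same degree of
  \<open>UJ2\<close>.\<close>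

lemma T_ideal_T_Ass:
  assumes "CHAR('k::field) \<noteq> 2"
  shows "T_ideal (T_Ass :: 'k free_jordan set)"
proof -
  have "jord.subspace (T_Ass :: 'k free_jordan set)"
    by (auto simp: jord.subspace_def T_Ass_def ass_substD)
  moreover have "f * u \<in> T_Ass \<and> u * f \<in> T_Ass" if "f \<in> T_Ass" for f u :: "'k free_jordan"
  proof -
    have "\<phi> (f * u) = 0 \<and> \<phi> (u * f) = 0" if "ass_subst \<phi>" for \<phi>
    proof -
      have "\<phi> f = 0" using that \<open>f \<in> T_Ass\<close> by (simp add: T_Ass_def)
      then show ?thesis by (simp add: ass_substD[OF that] jmul_zero)
    qed
    then show ?thesis by (simp add: T_Ass_def)
  qed
  moreover have "\<psi> f \<in> T_Ass" if "graded_endo \<psi>" "f \<in> T_Ass" for \<psi> and f :: "'k free_jordan"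
  proof -
    have "ass_subst (\<lambda>f. \<phi> (\<psi> f))" if \<phi>: "ass_subst \<phi>" for \<phi>
    proof -
      interpret Vector_Spaces.linear jscale jscale \<psi> using \<open>graded_endo \<psi>\<close> by (simp add: graded_endo_def)
      have "Vector_Spaces.linear jscale mscale (\<lambda>f. \<phi> (\<psi> f))"
        by unfold_locales (simp_all add: add scale ass_substD[OF \<phi>])
      moreover have "\<psi> (yv i) \<in> jgrade 0" "\<psi> (zv i) \<in> jgrade 1" for i
        using \<open>graded_endo \<psi>\<close> unfolding graded_endo_def by (blast intro: jgrade_yv jgrade_zv)+
      ultimately show ?thesis
        using \<phi> \<open>graded_endo \<psi>\<close> ass_subst_grade[OF assms \<phi>]
        unfolding ass_subst_def graded_endo_def by auto
    qed
    with \<open>f \<in> T_Ass\<close> show ?thesis by (auto simp: T_Ass_def)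
  qed
  ultimately show ?thesis unfolding T_ideal_def jideal_def by blast
qed

text \<open>This is \<open>c\<close> times the n-th power of \<open>h\<close>, in view of
  \<open>h h = 1\<close>.\<close>

definition odd_unit_power :: "nat \<Rightarrow> 'k::field \<Rightarrow> 'k^2^2"
  where "odd_unit_power n c = (if even n then Mx c 0 0 else Mx 0 0 c)"

lemma jmul_odd_unit_power:
  fixes c :: "'k::field"
  assumes "CHAR('k) \<noteq> 2"
  shows "jmul (odd_unit_power m c) (odd_unit_power n d) = odd_unit_power (m + n) (c * d)"
  by (simp add: odd_unit_power_def jmul_Mx[OF assms])

text \<open>The coordinate of \<open>e\<close> follows the derivative of the power, as
  \<open>e e = 0\<close>. For exponent q it vanishes, so a q-th power of an even element evaluates
  to a scalar.\<close>

lemma ass_subst_lpow_yv: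
  fixes \<phi> :: "'k::field free_jordan \<Rightarrow> 'k^2^2"
  assumes "CHAR('k) \<noteq> 2" "ass_subst \<phi>" "\<phi> f = Mx a b 0"
  shows "\<phi> (lpow f n) = Mx (a ^ n) (of_nat n * a ^ (n - 1) * b) 0"
proof (induction n)
  case (Suc n)
  show ?case
    using Suc by (cases n)
     (simp_all add: ass_substD[OF assms(2)] assms(3) jmul_Mx[OF assms(1)] algebra_simps)
qed (simp add: ass_substD[OF assms(2)])

lemma ass_subst_lpow_zv:
  fixes \<phi> :: "'k::field free_jordan \<Rightarrow> 'k^2^2"
  assumes "CHAR('k) \<noteq> 2" "ass_subst \<phi>" "\<phi> f = Mx 0 0 c"
  shows "\<phi> (lpow f n) = odd_unit_power n (c ^ n)"
proof (induction n)
  case (Suc n)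
  have "\<phi> f = odd_unit_power 1 c" by (simp add: odd_unit_power_def assms(3))
  with Suc show ?case
    by (simp add: ass_substD[OF assms(2)] jmul_odd_unit_power[OF assms(1)] mult.commute)
qed (simp add: ass_substD[OF assms(2)] odd_unit_power_def)

text \<open>Under a substitution \<open>lpow y q - y\<close> becomes a multiple of \<open>e\<close>,
  which annihilates both \<open>e\<close> and \<open>h\<close>. For odd variables the generator
  vanishes because q is odd, so that the q-th power of \<open>h\<close> is \<open>h\<close>.\<close>

lemma I'_subset_T_Ass:
  assumes char: "CHAR('k::{field,finite}) \<noteq> 2"
  shows "I' \<subseteq> (T_Ass :: 'k free_jordan set)"
proof -
  have "f \<in> T_Ass" if f: "f \<in> ass_gens CARD('k)" for f :: "'k free_jordan"
    unfolding T_Ass_def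
  proof (intro CollectI allI impI)
    fix \<phi> :: "'k free_jordan \<Rightarrow> 'k^2^2" assume \<phi>: "ass_subst \<phi>"
    obtain a b c where y: "\<And>i. \<phi> (yv i) = Mx (a i) (b i) 0" and z: "\<And>i. \<phi> (zv i) = Mx 0 0 (c i)"
      by (rule ass_subst_var_cases[OF \<phi>]) blast
    have yq: "\<phi> (lpow (yv i) CARD('k)) = Mx (a i) 0 0" for i
      by (simp add: ass_subst_lpow_yv[OF char \<phi> y] power_card_eq_same of_nat_card_eq_0)
    have zq: "\<phi> (lpow (zv i) CARD('k)) = Mx 0 0 (c i)" for i
      using odd_card_field[OF char]
      by (simp add: ass_subst_lpow_zv[OF char \<phi> z] power_card_eq_same odd_unit_power_def)
    show "\<phi> f = 0"
      using f unfolding ass_gens_def associator_def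
      by (elim insertE) (simp_all add: ass_substD[OF \<phi>] y z yq zq jmul_Mx[OF char] Mx_simps
          ring_distribs mult_ac)
  qed
  then have "T_Ass \<in> {I. T_ideal I \<and> ass_gens CARD('k) \<subseteq> (I :: 'k free_jordan set)}"
    using T_ideal_T_Ass[OF char] by blast
  then show ?thesis unfolding I'_def T_ideal_gen_def by (rule Inter_lower)
qed

section \<open>Values of words and independence modulo the identities\<close>

lemma ass_subst_zword:
  fixes \<phi> :: "'k::field free_jordan \<Rightarrow> 'k^2^2"
  assumes "CHAR('k) \<noteq> 2" "ass_subst \<phi>" "\<And>i. \<phi> (zv i) = Mx 0 0 (c i)"
  shows "\<phi> (zword xs) = odd_unit_power (length xs) (mono_fun (mset xs) c)"
proof (induction xs)
  case (Cons i xs)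
  have "\<phi> (zv i) = odd_unit_power 1 (c i)" by (simp add: odd_unit_power_def assms(3))
  with Cons show ?case by (simp add: ass_substD[OF assms(2)] jmul_odd_unit_power[OF assms(1)])
qed (simp add: ass_substD[OF assms(2)] odd_unit_power_def)

text \<open>With \<open>e\<close> present in the value of a single variable, the coordinate of
  \<open>e\<close> in the value of a word is its formal partial derivative in that variable.\<close>

lemma ass_subst_yword:
  fixes \<phi> :: "'k::field free_jordan \<Rightarrow> 'k^2^2"
  assumes "CHAR('k) \<noteq> 2" "ass_subst \<phi>" "\<And>i. \<phi> (yv i) = Mx (a i) (if i = j then 1 else 0) 0"
  shows "\<phi> (yword xs) = Mx (mono_fun (mset xs) a)
    (of_nat (count (mset xs) j) * mono_fun (mset xs - {#j#}) a) 0"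
proof (induction xs)
  case (Cons i xs)
  show ?case
    using count_mono_fun[of "mset xs" j a] count_mono_fun_add_mset[of i j "mset xs" a]
    by (cases "i = j") (auto simp: ass_substD[OF assms(2)] assms(3) Cons jmul_Mx[OF assms(1)] algebra_simps)
qed (simp add: ass_substD[OF assms(2)])

text \<open>Merging both kinds of letters into one multiset turns monomials into functions of a
  single assignment on \<open>var\<close>, the setting of the independence lemmas.\<close>

definition yz_vars :: "nat multiset \<times> nat multiset \<Rightarrow> var multiset"
  where "yz_vars s = image_mset YVar (fst s) + image_mset ZVar (snd s)"

lemma count_yz_vars [simp]:
  "count (yz_vars (M, N)) (YVar i) = count M i" "count (yz_vars (M, N)) (ZVar i) = count N i"
proof -
  have "count (image_mset f M) (f i) = count M i" if "inj f" for f :: "nat \<Rightarrow> var" and M i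
    using that by (induction M) (auto simp: inj_def)
  moreover have "inj YVar" "inj ZVar" by (auto simp: inj_def)
  moreover have "count (image_mset YVar M) (ZVar i) = 0" "count (image_mset ZVar N) (YVar i) = 0"
    by (auto simp: count_eq_zero_iff)
  ultimately show "count (yz_vars (M, N)) (YVar i) = count M i"
    "count (yz_vars (M, N)) (ZVar i) = count N i"
    by (simp_all add: yz_vars_def)
qed

lemma inj_yz_vars: "inj yz_vars"
proof (rule injI)
  fix s s' assume *: "yz_vars s = yz_vars s'"
  obtain M N M' N' where s: "s = (M, N)" "s' = (M', N')" by (metis surj_pair)
  have "count M i = count M' i" "count N i = count N' i" for i
    using arg_cong[OF *, of "\<lambda>S. count S (YVar i)"] arg_cong[OF *, of "\<lambda>S. count S (ZVar i)"]
    by (simp_all add: s)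
  then show "s = s'" by (simp add: s multiset_eq_iff)
qed

lemma mono_fun_yz_vars:
  "mono_fun (yz_vars (M, N)) x = mono_fun M (\<lambda>i. x (YVar i)) * mono_fun N (\<lambda>i. x (ZVar i))"
  by (simp add: yz_vars_def mono_fun_def image_mset.compositionality o_def)

lemma mono_fun_yz_vars_diff:
  "of_nat (count M j) * mono_fun (yz_vars (M, N) - {#YVar j#}) x
    = of_nat (count M j) * mono_fun (M - {#j#}) (\<lambda>i. x (YVar i)) * mono_fun N (\<lambda>i. x (ZVar i))"
proof (cases "j \<in># M")
  case True
  then have "yz_vars (M, N) - {#YVar j#} = yz_vars (M - {#j#}, N)"
    by (auto simp: yz_vars_def dest!: multi_member_split)
  then show ?thesis by (simp add: mono_fun_yz_vars mult.assoc)
qed (simp add: not_in_iff)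

text \<open>The coordinates of 1, \<open>h\<close> and \<open>e\<close> give three separate
  relations. A monomial with an odd number of odd letters has only an \<open>h\<close>-coordinate,
  since \<open>e h = 0\<close>. Derivatives are thus available for the even part only, and this
  matches the stricter exponent bound that \<open>reduced\<close> imposes on the odd part.\<close>

lemma yzmon_independent_T_Ass:
  fixes \<gamma> :: "nat multiset \<times> nat multiset \<Rightarrow> 'k::{field,finite}"
  assumes char: "CHAR('k) \<noteq> 2" and F: "finite F" "F \<subseteq> reduced CARD('k)"
    and T: "(\<Sum>s\<in>F. jscale (\<gamma> s) (case_prod yzmon s)) \<in> T_Ass" and s: "s \<in> F"
  shows "\<gamma> s = 0"
proof -
  let ?m = "\<lambda>s x. mono_fun (yz_vars s) x"
  define Fe where "Fe = {s\<in>F. even (size (snd s))}"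
  define Fo where "Fo = {s\<in>F. odd (size (snd s))}"
  have fin: "finite Fe" "finite Fo" using F by (auto simp: Fe_def Fo_def)
  have eqs: "(\<Sum>s\<in>Fe. \<gamma> s * ?m s x) = 0 \<and> (\<Sum>s\<in>Fo. \<gamma> s * ?m s x) = 0 \<and>
    (\<Sum>s\<in>Fe. \<gamma> s * (of_nat (count (yz_vars s) (YVar j)) * mono_fun (yz_vars s - {#YVar j#}) x)) = 0"
    for x :: "var \<Rightarrow> 'k" and j
  proof -
    obtain \<phi> :: "'k free_jordan \<Rightarrow> 'k^2^2" where \<phi>: "ass_subst \<phi>"
      and y: "\<And>i. \<phi> (yv i) = Mx (x (YVar i)) (if i = j then 1 else 0) 0"
      and z: "\<And>i. \<phi> (zv i) = Mx 0 0 (x (ZVar i))"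
      using ass_subst_ex[OF char, of "\<lambda>i. x (YVar i)" "\<lambda>i. if i = j then 1 else 0" "\<lambda>i. x (ZVar i)"] by blast
    let ?d = "\<lambda>s. of_nat (count (yz_vars s) (YVar j)) * mono_fun (yz_vars s - {#YVar j#}) x"
    have val: "\<phi> (case_prod yzmon s) =
        (if even (size (snd s)) then Mx (?m s x) (?d s) 0 else Mx 0 0 (?m s x))" for s
      by (cases s) (simp add: yzmon_def ass_substD[OF \<phi>] ass_subst_zword[OF char \<phi> z]
          ass_subst_yword[OF char \<phi> y] odd_unit_power_def jmul_Mx[OF char] mono_fun_yz_vars
          mono_fun_yz_vars_diff)
    have sum_Mx: "(\<Sum>s\<in>A. Mx (p s) (e s) (h s)) = Mx (sum p A) (sum e A) (sum h A)"
      for A and p e h :: "nat multiset \<times> nat multiset \<Rightarrow> 'k"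
      by (induction A rule: infinite_finite_induct) (simp_all add: Mx_simps)
    have "\<phi> (\<Sum>s\<in>F. jscale (\<gamma> s) (case_prod yzmon s)) = 0"
      using T \<phi> unfolding T_Ass_def by blast
    then have "(\<Sum>s\<in>F. mscale (\<gamma> s) (\<phi> (case_prod yzmon s))) = 0"
      by (simp only: ass_substD(5,6)[OF \<phi>])
    moreover have "F = Fe \<union> Fo" "Fe \<inter> Fo = {}" by (auto simp: Fe_def Fo_def)
    ultimately have "0 = (\<Sum>s\<in>Fe. mscale (\<gamma> s) (\<phi> (case_prod yzmon s)))
        + (\<Sum>s\<in>Fo. mscale (\<gamma> s) (\<phi> (case_prod yzmon s)))"
      by (simp add: sum.union_disjoint fin)
    also have "(\<Sum>s\<in>Fe. mscale (\<gamma> s) (\<phi> (case_prod yzmon s)))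
        = (\<Sum>s\<in>Fe. Mx (\<gamma> s * ?m s x) (\<gamma> s * ?d s) 0)"
      by (intro sum.cong refl) (simp add: val Mx_simps Fe_def)
    also have "(\<Sum>s\<in>Fo. mscale (\<gamma> s) (\<phi> (case_prod yzmon s)))
        = (\<Sum>s\<in>Fo. Mx 0 0 (\<gamma> s * ?m s x))"
      by (intro sum.cong refl) (simp add: val Mx_simps Fo_def)
    finally show ?thesis
      by (simp add: sum_Mx Mx_simps Mx_eq_0_iff[OF char] eq_commute[of 0])
  qed
  have red: "(fst s, snd s) \<in> reduced CARD('k)" if "s \<in> F" for s using F that by auto
  show ?thesis
  proof (cases "even (size (snd s))")
    case True
    show ?thesis
    proof (rule mono_fun_derivative_independent[OF char fin(1) inj_on_subset[OF inj_yz_vars], of \<gamma>])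
      show "s \<in> Fe" using s True by (simp add: Fe_def)
      show "count (yz_vars s) v < 2 * CARD('k)" if "s \<in> Fe" for s v
        using red[of s] that by (cases s; cases v) (auto simp: Fe_def reduced_def intro: less_trans)
      show "count (yz_vars s) w < CARD('k)"
        if "s \<in> Fe" "v \<noteq> w" "CARD('k) \<le> count (yz_vars s) v" for s v w
        using red[of s] that by (cases s; cases v; cases w) (auto simp: Fe_def reduced_def not_less[symmetric])
      show "(\<Sum>s\<in>Fe. \<gamma> s * (of_nat (count (yz_vars s) v) * mono_fun (yz_vars s - {#v#}) x)) = 0"
        if "s \<in> Fe" "CARD('k) \<le> count (yz_vars s) v" for x s v
        using red[of s] that eqs[of x]
        by (cases s; cases v) (auto simp: Fe_def reduced_def not_less[symmetric])
    qed (use eqs in auto)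
  next
    case False
    show ?thesis
    proof (rule mono_fun_independent_family[OF fin(2) inj_on_subset[OF inj_yz_vars], of \<gamma>])
      show "s \<in> Fo" using s False by (simp add: Fo_def)
      show "count (yz_vars s) v < CARD('k)" if "s \<in> Fo" for s v
        using red[of s] that by (cases s; cases v) (auto simp: Fo_def reduced_def)
    qed (use eqs in auto)
  qed
qed

subsection \<open>The basis\<close>

definition exponent_mset :: "(nat \<Rightarrow> nat) \<Rightarrow> nat \<Rightarrow> nat \<Rightarrow> nat multiset"
  where "exponent_mset t j s = (\<Sum>i=j..<s. replicate_mset (t i) i)"

lemma count_exponent_mset: "count (exponent_mset t j s) i = (if j \<le> i \<and> i < s then t i else 0)"
  by (simp add: exponent_mset_def count_sum)

lemma exponent_mset_count: "set_mset N \<subseteq> {j..<s} \<Longrightarrow> exponent_mset (count N) j s = N"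
  by (rule multiset_eqI) (auto simp: count_exponent_mset not_in_iff[symmetric])

lemma size_exponent_mset: "size (exponent_mset t j s) = (\<Sum>i=j..<s. t i)"
  by (simp add: exponent_mset_def size_multiset_sum)

lemma coset_ymon:
  "mset xs = exponent_mset k 0 r \<Longrightarrow> coset (ymon k r) = coset (yword xs :: 'k::{field,finite} free_jordan)"
proof (rule coset_eq_even)
  have "(ymon k r :: 'k free_jordan) \<in> jgrade 0 \<and> even_coset (ymon k r :: 'k free_jordan) = yprod (exponent_mset k 0 r)"
    by (induction r) (simp_all add: ymon_def exponent_mset_def coset_simps even_coset_lpow)
  then show "(ymon k r :: 'k free_jordan) \<in> jgrade 0"
    "mset xs = exponent_mset k 0 r \<Longrightarrow> even_coset (ymon k r) = even_coset (yword xs :: 'k free_jordan)"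
    by (simp_all add: even_coset_yword)
qed simp

lemma ass_subst_zmon:
  fixes \<phi> :: "'k::field free_jordan \<Rightarrow> 'k^2^2"
  assumes "CHAR('k) \<noteq> 2" "ass_subst \<phi>" "\<And>i. \<phi> (zv i) = Mx 0 0 (c i)"
  shows "\<phi> (zmon t j s) = odd_unit_power (size (exponent_mset t j s)) (mono_fun (exponent_mset t j s) c)"
proof (induction s)
  case (Suc s)
  show ?case
  proof (cases "j \<le> s")
    case True
    with Suc show ?thesis
      by (simp add: zmon_def exponent_mset_def ass_substD[OF assms(2)] ass_subst_lpow_zv[OF assms]
          jmul_odd_unit_power[OF assms(1)])
  qed (simp add: zmon_def exponent_mset_def ass_substD[OF assms(2)] odd_unit_power_def)
qed (simp add: zmon_def exponent_mset_def ass_substD[OF assms(2)] odd_unit_power_def)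

lemma coset_eqI:
  fixes f g :: "'k::{field,finite} free_jordan"
  assumes "T_Ass = (I' :: 'k free_jordan set)" "\<And>\<phi>. ass_subst \<phi> \<Longrightarrow> \<phi> f = \<phi> g"
  shows "coset f = coset g"
  using assms(2) unfolding coset_eq_iff assms(1)[symmetric] T_Ass_def by (simp add: ass_substD)

text \<open>Lets computations in cosets, such as reordering of letters, be used inside evaluations;
  the easy inclusion of the ideals is enough for this.\<close>

lemma ass_subst_coset_cong:
  fixes f g :: "'k::{field,finite} free_jordan"
  assumes "CHAR('k) \<noteq> 2" "ass_subst \<phi>" "coset f = coset g"
  shows "\<phi> f = \<phi> g"
proof -
  have "f - g \<in> T_Ass" using assms(3) I'_subset_T_Ass[OF assms(1)] by (auto simp: coset_eq_iff)
  with assms(2) have "\<phi> (f - g) = 0" by (simp add: T_Ass_def)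
  then show ?thesis by (simp add: ass_substD[OF assms(2)])
qed

lemma ass_subst_yzmon_exponent_mset:
  fixes \<phi> :: "'k::{field,finite} free_jordan \<Rightarrow> 'k^2^2"
  assumes "CHAR('k) \<noteq> 2" "ass_subst \<phi>" "\<And>i. \<phi> (zv i) = Mx 0 0 (c i)"
  shows "\<phi> (yzmon (exponent_mset k 0 r) N) = jmul (\<phi> (ymon k r)) (odd_unit_power (size N) (mono_fun N c))"
proof -
  have "\<phi> (yword (sorted_list_of_multiset (exponent_mset k 0 r))) = \<phi> (ymon k r)"
    by (rule ass_subst_coset_cong[OF assms(1,2)]) (rule coset_ymon[symmetric], simp)
  then show ?thesis
    by (simp add: yzmon_def ass_substD[OF assms(2)] ass_subst_zword[OF assms])
qed

lemma ass_subst_yzmon_add_replicate: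
  fixes \<phi> :: "'k::{field,finite} free_jordan \<Rightarrow> 'k^2^2"
  assumes "CHAR('k) \<noteq> 2" "ass_subst \<phi>" "\<phi> (yv i) = Mx a b 0" "even (size N)"
  shows "\<phi> (yzmon (M + replicate_mset CARD('k) i) N) = jmul (Mx a 0 0) (\<phi> (yzmon M N))"
proof -
  have "even_coset (yzmon (M + replicate_mset CARD('k) i) N)
      = even_coset (lpow (yv i) CARD('k) * yzmon M N :: 'k free_jordan)"
    using assms(4) by (simp add: even_coset_yzmon coset_simps yzmon_jgrade even_coset_lpow mult_ac)
  then have "coset (yzmon (M + replicate_mset CARD('k) i) N)
      = coset (lpow (yv i) CARD('k) * yzmon M N :: 'k free_jordan)"
    using assms(4) by (intro coset_eq_even) (simp_all add: yzmon_jgrade)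
  then have "\<phi> (yzmon (M + replicate_mset CARD('k) i) N) = \<phi> (lpow (yv i) CARD('k) * yzmon M N)"
    by (rule ass_subst_coset_cong[OF assms(1,2)])
  then show ?thesis
    by (simp add: ass_substD[OF assms(2)] ass_subst_lpow_yv[OF assms(1-3)] power_card_eq_same
        of_nat_card_eq_0)
qed

lemma reducedI:
  assumes "\<And>m. count M m < q" "\<And>m. count N m < q"
  shows "(M, N) \<in> reduced q"
proof -
  have "count M m < 2 * q" for m using assms(1)[of m] by simp
  with assms show ?thesis by (simp add: reduced_def)
qed

lemma reduced_add_replicate:
  assumes "\<And>m. count M m < q" "\<And>m. count N m < q" "even (size N)"
  shows "(M + replicate_mset q i, N) \<in> reduced q"
proof -
  have "count (M + replicate_mset q i) m < 2 * q" for m using assms(1)[of m] assms(1)[of i] by auto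
  moreover have "count (M + replicate_mset q i) m < q" if "q \<le> count (M + replicate_mset q i) n" "n \<noteq> m" for m n
    using that assms(1)[of m] assms(1)[of n] by (auto split: if_splits)
  ultimately show ?thesis using assms(2,3) by (auto simp: reduced_def)
qed

lemma ymon_jgrade: "ymon k r \<in> jgrade 0"
  by (induction r) (simp_all add: ymon_def)

context
  assumes char: "CHAR('k::{field,finite}) \<noteq> 2" and T: "T_Ass = (I' :: 'k free_jordan set)"
begin

lemma coset_ymon_zmon:
  "coset (ymon k r * zmon t j s :: 'k free_jordan) = coset (yzmon (exponent_mset k 0 r) (exponent_mset t j s))"
proof (rule coset_eqI[OF T])
  fix \<phi> :: "'k free_jordan \<Rightarrow> 'k^2^2" assume \<phi>: "ass_subst \<phi>"
  obtain a b c where "\<And>i. \<phi> (yv i) = Mx (a i) (b i) 0" and z: "\<And>i. \<phi> (zv i) = Mx 0 0 (c i)"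
    by (rule ass_subst_var_cases[OF \<phi>]) blast
  show "\<phi> (ymon k r * zmon t j s) = \<phi> (yzmon (exponent_mset k 0 r) (exponent_mset t j s))"
    by (simp add: ass_substD[OF \<phi>] ass_subst_zmon[OF char \<phi> z] ass_subst_yzmon_exponent_mset[OF char \<phi> z])
qed

lemma coset_form_c:
  assumes "even (size (exponent_mset t j s))"
  shows "coset ((ymon k r * zv j) * zmon t j s :: 'k free_jordan)
    = coset (yzmon (exponent_mset k 0 r) (add_mset j (exponent_mset t j s)))"
proof (rule coset_eqI[OF T])
  fix \<phi> :: "'k free_jordan \<Rightarrow> 'k^2^2" assume \<phi>: "ass_subst \<phi>"
  obtain a b c where "\<And>i. \<phi> (yv i) = Mx (a i) (b i) 0" and z: "\<And>i. \<phi> (zv i) = Mx 0 0 (c i)"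
    by (rule ass_subst_var_cases[OF \<phi>]) blast
  obtain A D where "\<phi> (ymon k r) = Mx A D 0"
    using ass_subst_grade[OF char \<phi> ymon_jgrade, of k r] unfolding UJ2_ass_grade_0 by blast
  with assms show "\<phi> ((ymon k r * zv j) * zmon t j s) = \<phi> (yzmon (exponent_mset k 0 r) (add_mset j (exponent_mset t j s)))"
    by (simp add: ass_substD[OF \<phi>] ass_subst_zmon[OF char \<phi> z] ass_subst_yzmon_exponent_mset[OF char \<phi> z]
        z jmul_Mx[OF char] odd_unit_power_def mult_ac)
qed

text \<open>The factor \<open>(yv i * zv j) * zv l\<close> evaluates to a scalar, because
  \<open>e h = 0\<close> removes the nilpotent part of the even variable and \<open>h h = 1\<close>.
  The q-th power of \<open>yv i\<close> supplies the same scalar part.\<close>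

lemma coset_form_d:
  assumes "even (size (exponent_mset t l s))"
  shows "coset ((((yv i * zv j) * zv l) * ymon k r) * zmon t l s :: 'k free_jordan)
    = coset (yzmon (exponent_mset k 0 r + replicate_mset CARD('k) i) (add_mset j (add_mset l (exponent_mset t l s))))"
proof (rule coset_eqI[OF T])
  fix \<phi> :: "'k free_jordan \<Rightarrow> 'k^2^2" assume \<phi>: "ass_subst \<phi>"
  obtain a b c where y: "\<And>i. \<phi> (yv i) = Mx (a i) (b i) 0" and z: "\<And>i. \<phi> (zv i) = Mx 0 0 (c i)"
    by (rule ass_subst_var_cases[OF \<phi>]) blast
  obtain A D where "\<phi> (ymon k r) = Mx A D 0"
    using ass_subst_grade[OF char \<phi> ymon_jgrade, of k r] unfolding UJ2_ass_grade_0 by blast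
  with assms show "\<phi> ((((yv i * zv j) * zv l) * ymon k r) * zmon t l s)
    = \<phi> (yzmon (exponent_mset k 0 r + replicate_mset CARD('k) i) (add_mset j (add_mset l (exponent_mset t l s))))"
    by (simp add: ass_substD[OF \<phi>] ass_subst_zmon[OF char \<phi> z] ass_subst_yzmon_exponent_mset[OF char \<phi> z]
        ass_subst_yzmon_add_replicate[OF char \<phi> y] y z jmul_Mx[OF char] odd_unit_power_def mult_ac)
qed

text \<open>The smaller bounds on the first exponent of \<open>zmon\<close> in forms (c) and (d)
  leave room for the odd factors that stand outside it, two of them with the same index when
  \<open>j = l\<close>.\<close>

lemma coset_forms_subset:
  "coset ` (form_a CARD('k) \<union> form_b CARD('k) \<union> form_c CARD('k) \<union> form_d CARD('k))
    \<subseteq> (\<lambda>(M, N). coset (yzmon M N :: 'k free_jordan)) ` reduced CARD('k)" (is "coset ` ?F \<subseteq> ?R")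
proof (rule image_subsetI)
  let ?q = "CARD('k)"
  have q: "?q \<ge> 3" by (rule card_field_ge_3[OF char])
  have mem: "coset f \<in> ?R" if "coset f = coset (yzmon M N)" "(M, N) \<in> reduced ?q"
    for f :: "'k free_jordan" and M N
    using that by (auto intro!: image_eqI[of _ _ "(M, N)"])
  fix f assume "f \<in> ?F"
  then consider "f \<in> form_a ?q" | "f \<in> form_b ?q" | "f \<in> form_c ?q" | "f \<in> form_d ?q" by blast
  then show "coset f \<in> ?R"
  proof cases
    case 1
    then obtain k r where f: "f = ymon k r" and k: "k \<in> Lambda ?q r" by (auto simp: form_a_def)
    have "coset f = coset (yzmon (exponent_mset k 0 r) {#})"
      using coset_ymon_zmon[of k r "\<lambda>_. 0" 0 0] by (simp add: f zmon_def exponent_mset_def)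
    moreover have "(exponent_mset k 0 r, {#}) \<in> reduced ?q"
      using k q by (auto simp: reduced_def count_exponent_mset Lambda_def)
    ultimately show ?thesis by (rule mem)
  next
    case 2
    then obtain k r t s where f: "f = ymon k r * zmon t 0 s"
      and *: "\<forall>i<r. k i < ?q" "\<forall>i<s. t i < ?q" "even (\<Sum>i<s. t i)"
      by (auto simp: form_b_def)
    have "(exponent_mset k 0 r, exponent_mset t 0 s) \<in> reduced ?q"
      using * q by (intro reducedI) (simp_all add: count_exponent_mset)
    with coset_ymon_zmon show ?thesis unfolding f by (rule mem)
  next
    case 3
    then obtain k r j t s where f: "f = (ymon k r * zv j) * zmon t j s"
      and *: "\<forall>i<r. k i < ?q" "j < s" "t j < ?q - 1" "\<forall>i\<in>{j<..<s}. t i < ?q" "even (\<Sum>i=j..<s. t i)"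
      by (auto simp: form_c_def)
    have ev: "even (size (exponent_mset t j s))" using * by (simp add: size_exponent_mset)
    have "(exponent_mset k 0 r, add_mset j (exponent_mset t j s)) \<in> reduced ?q"
    proof (rule reducedI)
      show "count (exponent_mset k 0 r) m < ?q" for m using * q by (simp add: count_exponent_mset)
      show "count (add_mset j (exponent_mset t j s)) m < ?q" for m
        using * q by (cases "m = j") (auto simp: count_exponent_mset)
    qed
    with coset_form_c[OF ev] show ?thesis unfolding f by (rule mem)
  next
    case 4
    then obtain i j l k r t s where f: "f = (((yv i * zv j) * zv l) * ymon k r) * zmon t l s"
      and *: "\<forall>m<r. k m < ?q" "j \<le> l" "l < s" "\<forall>m\<in>{l<..<s}. t m < ?q"
        "even (\<Sum>m=l..<s. t m)" "j < l \<longrightarrow> t l < ?q - 1" "j = l \<longrightarrow> t l < ?q - 2"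
      by (auto simp: form_d_def)
    have ev: "even (size (exponent_mset t l s))" using * by (simp add: size_exponent_mset)
    have "(exponent_mset k 0 r + replicate_mset ?q i, add_mset j (add_mset l (exponent_mset t l s))) \<in> reduced ?q"
    proof (rule reduced_add_replicate)
      show "count (exponent_mset k 0 r) m < ?q" for m using * q by (simp add: count_exponent_mset)
      have "count (exponent_mset t l s) m < ?q" if "m \<noteq> l" for m using that * q by (auto simp: count_exponent_mset)
      moreover have "count (exponent_mset t l s) m = 0" if "m < l" for m using that by (simp add: count_exponent_mset)
      moreover have "count (exponent_mset t l s) l = t l" using * by (simp add: count_exponent_mset)
      ultimately show "count (add_mset j (add_mset l (exponent_mset t l s))) m < ?q" for m
        using * q by (cases "j = l"; cases "m = l"; cases "m = j") auto
    qed (use ev in simp)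
    with coset_form_d[OF ev] show ?thesis unfolding f by (rule mem)
  qed
qed

lemma reduced_subset_coset_forms:
  "(\<lambda>(M, N). coset (yzmon M N :: 'k free_jordan)) ` reduced CARD('k)
    \<subseteq> coset ` (form_a CARD('k) \<union> form_b CARD('k) \<union> form_c CARD('k) \<union> form_d CARD('k))"
proof (rule image_subsetI, clarify)
  let ?q = "CARD('k)"
  have q: "?q \<ge> 3" by (rule card_field_ge_3[OF char])
  have bound: "\<exists>r\<ge>1. set_mset M \<subseteq> {0..<r}" for M :: "nat multiset"
  proof -
    obtain r where "set_mset M \<subseteq> {..<r}" using finite_nat_iff_bounded[of "set_mset M"] by auto
    then show ?thesis by (intro exI[of _ "Suc r"]) force
  qed
  \<comment> \<open>The indices \<open>j\<close> and \<open>l\<close> of the forms are found by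
    removing the least letter of \<open>N\<close>, once or twice; what remains then starts at the
    required index.\<close>
  have from_Min: "\<exists>j N'. N = add_mset j N' \<and> (\<forall>i\<in>#N'. j \<le> i)" if "N \<noteq> {#}" for N :: "nat multiset"
  proof (intro exI conjI ballI)
    have "Min (set_mset N) \<in># N" using that by (intro Min_in) auto
    then show "N = add_mset (Min (set_mset N)) (N - {#Min (set_mset N)#})" by simp
    show "Min (set_mset N) \<le> i" if "i \<in># N - {#Min (set_mset N)#}" for i
      using that by (intro Min_le) (auto dest: in_diffD)
  qed
  have sum0: "(\<Sum>i<s. t i) = (\<Sum>i=0..<s. t i)" for t :: "nat \<Rightarrow> nat" and s
    by (simp add: atLeast0LessThan)
  fix M N assume MN: "(M, N) \<in> reduced ?q"
  obtain r where r: "r \<ge> 1" "set_mset M \<subseteq> {0..<r}" using bound by blast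
  \<comment> \<open>Form (a) absorbs large even exponents when there are no odd letters. Form (d)
    thus needs only nonempty \<open>N\<close> of even size, from which two letters can be
    taken.\<close>
  consider "N = {#}" | "N \<noteq> {#}" "even (size N)" "\<forall>i. count M i < ?q"
    | i where "N \<noteq> {#}" "even (size N)" "?q \<le> count M i" | "odd (size N)"
    using leI by blast
  then show "coset (yzmon M N :: 'k free_jordan)
    \<in> coset ` (form_a ?q \<union> form_b ?q \<union> form_c ?q \<union> form_d ?q)"
  proof cases
    case 1
    have "coset (yzmon M N :: 'k free_jordan) = coset (ymon (count M) r)"
      using coset_ymon_zmon[of "count M" r "\<lambda>_. 0" 0 0]
      by (simp add: 1 zmon_def exponent_mset_count[OF r(2)]) (simp add: exponent_mset_def)
    moreover have "count M \<in> Lambda ?q r"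
      using MN by (simp add: Lambda_def reduced_def) metis
    then have "(ymon (count M) r :: 'k free_jordan) \<in> form_a ?q"
      using r(1) by (auto simp: form_a_def)
    ultimately show ?thesis by blast
  next
    case 2
    obtain s where s: "s \<ge> 1" "set_mset N \<subseteq> {0..<s}" using bound by blast
    have "coset (yzmon M N :: 'k free_jordan) = coset (ymon (count M) r * zmon (count N) 0 s)"
      by (simp add: coset_ymon_zmon exponent_mset_count[OF r(2)] exponent_mset_count[OF s(2)])
    moreover have "(\<Sum>i<s. count N i) = size N"
      using size_exponent_mset[of "count N" 0 s] by (simp add: exponent_mset_count[OF s(2)] sum0)
    then have "(ymon (count M) r * zmon (count N) 0 s :: 'k free_jordan) \<in> form_b ?q"
      unfolding form_b_def mem_Collect_eq using MN r(1) s(1) 2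
      by (intro exI[of _ "count M"] exI[of _ r] exI[of _ "count N"] exI[of _ s])
        (auto simp: reduced_def nonempty_has_size)
    ultimately show ?thesis by blast
  next
    case (3 i)
    define M' where "M' = M - replicate_mset ?q i"
    have M: "M = M' + replicate_mset ?q i"
      unfolding M'_def using 3(3) by (rule replicate_subset_mset)
    have M': "set_mset M' \<subseteq> {0..<r}" using r(2) by (auto simp: M)
    have M'q: "count M' m < ?q" for m
    proof -
      have "count M m < 2 * ?q" using MN by (simp add: reduced_def)
      moreover have "count M m < ?q" if "m \<noteq> i"
      proof -
        have "\<forall>i j. i \<noteq> j \<longrightarrow> ?q \<le> count M i \<longrightarrow> count M j < ?q"
          using MN by (simp add: reduced_def)
        from this[rule_format, OF that[symmetric] 3(3)] show ?thesis .
      qed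
      ultimately show ?thesis using q by (cases "m = i") (auto simp: M'_def)
    qed
    obtain j N1 where N1: "N = add_mset j N1" "\<forall>m\<in>#N1. j \<le> m" using from_Min 3(1) by blast
    then have "N1 \<noteq> {#}" using 3(2) by auto
    then obtain l N2 where N2: "N1 = add_mset l N2" "\<forall>m\<in>#N2. l \<le> m" using from_Min by blast
    have jl: "j \<le> l" using N1 N2 by simp
    obtain s where s: "set_mset N \<subseteq> {0..<s}" using bound by blast
    have N2s: "set_mset N2 \<subseteq> {l..<s}" "l < s" using s N1 N2 by auto
    have ev: "even (size N2)" using 3(2) by (simp add: N1 N2)
    let ?f = "(((yv i * zv j) * zv l) * ymon (count M') r) * zmon (count N2) l s :: 'k free_jordan"
    have "coset (yzmon M N) = coset ?f"
      using coset_form_d[of "count N2" l s i j "count M'" r] ev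
      by (simp add: exponent_mset_count[OF M'] exponent_mset_count[OF N2s(1)] M N1 N2)
    moreover have Nq: "count N2 m + (if m = l then 1 else 0) + (if m = j then 1 else 0) < ?q" for m
    proof -
      have "count N m < ?q" using MN by (simp add: reduced_def)
      then show ?thesis by (auto simp: N1 N2)
    qed
    have "even (\<Sum>m=l..<s. count N2 m)"
      using ev size_exponent_mset[of "count N2" l s] by (simp add: exponent_mset_count[OF N2s(1)])
    moreover have "count N2 m < ?q" for m using Nq[of m] by simp
    moreover have "j < l \<longrightarrow> count N2 l < ?q - 1" "j = l \<longrightarrow> count N2 l < ?q - 2"
      using Nq[of l] by auto
    ultimately have "?f \<in> form_d ?q"
      unfolding form_d_def mem_Collect_eq using r(1) M'q jl N2s(2) by blast
    with \<open>coset (yzmon M N) = coset ?f\<close> show ?thesis by blast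
  next
    case 4
    then have "N \<noteq> {#}" by auto
    then obtain j N1 where N1: "N = add_mset j N1" "\<forall>m\<in>#N1. j \<le> m" using from_Min by blast
    obtain s where s: "set_mset N \<subseteq> {0..<s}" using bound by blast
    have N1s: "set_mset N1 \<subseteq> {j..<s}" "j < s" using s N1 by auto
    have ev: "even (size N1)" using 4 by (simp add: N1)
    let ?f = "(ymon (count M) r * zv j) * zmon (count N1) j s :: 'k free_jordan"
    have eq: "coset (yzmon M N) = coset ?f"
      using coset_form_c[of "count N1" j s "count M" r] ev
      by (simp add: exponent_mset_count[OF r(2)] exponent_mset_count[OF N1s(1)] N1)
    have Nq: "count N1 m + (if m = j then 1 else 0) < ?q" for m
    proof -
      have "count N m < ?q" using MN by (simp add: reduced_def)
      then show ?thesis by (auto simp: N1)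
    qed
    have "even (\<Sum>m=j..<s. count N1 m)"
      using ev size_exponent_mset[of "count N1" j s] by (simp add: exponent_mset_count[OF N1s(1)])
    moreover have "count N1 m < ?q" for m using Nq[of m] by simp
    moreover have "count N1 j < ?q - 1" using Nq[of j] by auto
    moreover have "\<forall>i. count M i < ?q" using MN 4 by (simp add: reduced_def)
    ultimately have "?f \<in> form_c ?q"
      unfolding form_c_def mem_Collect_eq using r(1) N1s(2) by blast
    with eq show ?thesis by blast
  qed
qed

end

section \<open>Equality of the ideals and the basis\<close>

lemma span_reduced_eq_UNIV:
  assumes char: "CHAR('k::{field,finite}) \<noteq> 2"
  shows "jord.span (case_prod yzmon ` reduced CARD('k) \<union> I') = (UNIV :: 'k free_jordan set)"
    (is "?S = _")
proof -
  have "range (case_prod yzmon) \<union> I' \<subseteq> ?S"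
    using yzmon_in_span_reduced[OF char] by (auto intro: jord.span_base)
  then have "jord.span (range (case_prod yzmon) \<union> I') \<subseteq> ?S"
    by (simp add: jord.span_minimal)
  then show ?thesis by (auto simp: span_words_eq_UNIV[OF char])
qed

text \<open>Modulo \<open>I'\<close> an identity is a combination of reduced monomials. This
  combination is again an identity by the easy inclusion, so all its coefficients vanish.\<close>

lemma T_Ass_eq_I':
  assumes char: "CHAR('k::{field,finite}) \<noteq> 2"
  shows "T_Ass = (I' :: 'k free_jordan set)"
proof
  let ?X = "case_prod yzmon ` reduced CARD('k) :: 'k free_jordan set"
  show "T_Ass \<subseteq> (I' :: 'k free_jordan set)"
  proof
    fix f :: "'k free_jordan" assume f: "f \<in> T_Ass"
    have "f \<in> jord.span (?X \<union> I')" by (simp add: span_reduced_eq_UNIV[OF char])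
    then obtain g h where fgh: "f = g + h" "g \<in> jord.span ?X" "h \<in> jord.span I'"
      by (auto simp: jord.span_Un)
    moreover have "jord.span I' = (I' :: 'k free_jordan set)"
      by (simp add: jord.span_eq_iff subspace_I')
    ultimately have h: "h \<in> I'" by simp
    obtain A u where A: "finite A" "A \<subseteq> ?X" "g = (\<Sum>a\<in>A. jscale (u a) a)"
      using fgh(2) by (auto simp: jord.span_explicit)
    \<comment> \<open>\<open>F\<close> contains one index for each monomial in \<open>A\<close>,
      which permits reindexing without injectivity of \<open>yzmon\<close> on all of
      \<open>reduced\<close>.\<close>
    obtain F where F: "F \<subseteq> reduced CARD('k)" "inj_on (case_prod yzmon :: _ \<Rightarrow> 'k free_jordan) F" "A = case_prod yzmon ` F"
      using A(2) unfolding subset_image_inj by blast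
    then have "finite F" using A(1) finite_imageD by blast
    have g: "g = (\<Sum>s\<in>F. jscale (u (case_prod yzmon s)) (case_prod yzmon s))"
      using F(2) by (simp add: A(3) F(3) sum.reindex)
    have "g = f - h" by (simp add: fgh)
    moreover have "h \<in> T_Ass" using h I'_subset_T_Ass[OF char] by blast
    moreover have "jord.subspace (T_Ass :: 'k free_jordan set)"
      using T_ideal_T_Ass[OF char] by (simp add: T_ideal_def jideal_def)
    ultimately have "g \<in> T_Ass" using f by (simp add: jord.subspace_diff)
    then have "u (case_prod yzmon s) = 0" if "s \<in> F" for s
      using yzmon_independent_T_Ass[OF char \<open>finite F\<close> F(1), of "\<lambda>s. u (case_prod yzmon s)"] that
      by (simp add: g)
    then have "g = 0" by (simp add: g)
    then show "f \<in> I'" using h by (simp add: fgh)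
  qed
qed (rule I'_subset_T_Ass[OF char])

lemma coset_linear:
  fixes f g :: "'k::{field,finite} free_jordan"
  shows "coset (f + g) = coset f + coset g" "coset (jscale c f) = qscale c (coset f)" "coset 0 = (0 :: 'k jquot)"
  "coset (sum F A :: 'k free_jordan) = (\<Sum>s\<in>A. coset (F s))"
proof -
  show add: "coset (f + g) = coset f + coset g" for f g :: "'k free_jordan"
    by (simp add: plus_jquot.abs_eq)
  show "coset (jscale c f) = qscale c (coset f)" by (simp add: qscale.abs_eq)
  show zero: "coset 0 = (0 :: 'k jquot)" by (simp add: zero_jquot_def)
  show "coset (sum F A :: 'k free_jordan) = (\<Sum>s\<in>A. coset (F s))"
    by (induction A rule: infinite_finite_induct) (simp_all add: add zero)
qed

text \<open>A linear relation between cosets lifts to a combination lying in \<open>I'\<close>,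
  hence to an identity, and independence modulo the identities applies.\<close>

lemma independent_coset_reduced:
  assumes char: "CHAR('k::{field,finite}) \<noteq> 2"
  shows "quot.independent ((\<lambda>(M, N). coset (yzmon M N :: 'k free_jordan)) ` reduced CARD('k))"
proof
  let ?g = "\<lambda>s. coset (case_prod yzmon s :: 'k free_jordan)"
  have g: "(\<lambda>(M, N). coset (yzmon M N :: 'k free_jordan)) = ?g" by auto
  assume "quot.dependent ((\<lambda>(M, N). coset (yzmon M N :: 'k free_jordan)) ` reduced CARD('k))"
  then obtain A u v where A: "finite A" "A \<subseteq> ?g ` reduced CARD('k)" "(\<Sum>a\<in>A. qscale (u a) a) = 0"
    and v: "v \<in> A" "u v \<noteq> 0"
    by (auto simp: quot.dependent_explicit g)
  obtain F where F: "F \<subseteq> reduced CARD('k)" "inj_on ?g F" "A = ?g ` F"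
    using A(2) unfolding subset_image_inj by blast
  then have "finite F" using A(1) finite_imageD by blast
  have "coset (\<Sum>s\<in>F. jscale (u (?g s)) (case_prod yzmon s)) = coset 0"
    using A(3) F(2) by (simp add: F(3) sum.reindex coset_linear)
  then have "(\<Sum>s\<in>F. jscale (u (?g s)) (case_prod yzmon s)) \<in> T_Ass"
    using I'_subset_T_Ass[OF char] by (auto simp: coset_eq_iff)
  then have "u (?g s) = 0" if "s \<in> F" for s
    using yzmon_independent_T_Ass[OF char \<open>finite F\<close> F(1), of "\<lambda>s. u (?g s)"] that by simp
  with v F(3) show False by auto
qed

lemma span_coset_reduced:
  assumes char: "CHAR('k::{field,finite}) \<noteq> 2"
  shows "quot.span ((\<lambda>(M, N). coset (yzmon M N :: 'k free_jordan)) ` reduced CARD('k)) = UNIV"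
    (is "quot.span ?B = _")
proof -
  have "coset f \<in> quot.span ?B" for f :: "'k free_jordan"
  proof -
    have "f \<in> jord.span (case_prod yzmon ` reduced CARD('k) \<union> I')"
      by (simp add: span_reduced_eq_UNIV[OF char])
    then show ?thesis
    proof (induction rule: jord.span_induct_alt)
      case base
      show ?case by (simp add: coset_linear quot.span_zero)
    next
      case (step c x y)
      from step(1) have "coset x \<in> quot.span ?B"
      proof
        assume "x \<in> I'"
        then have "coset x = coset 0" by (simp add: coset_eq_iff)
        then show ?thesis by (simp add: coset_linear quot.span_zero)
      qed (auto intro!: quot.span_base)
      with step(2) show ?case by (simp add: coset_linear quot.span_add quot.span_scale)
    qed
  qed
  then have "x \<in> quot.span ?B" for x by (induct x) simp
  then show ?thesis by blast
qed

theorem theorem3p17: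
  fixes q :: nat
  assumes "q = CARD('k::{field,finite})" and "CHAR('k) \<noteq> 2"
  shows "(I' :: 'k free_jordan set) = T_Ass
    \<and> quot.independent (coset ` (form_a q \<union> form_b q \<union> form_c q \<union> form_d q) :: 'k jquot set)
    \<and> quot.span (coset ` (form_a q \<union> form_b q \<union> form_c q \<union> form_d q) :: 'k jquot set) = UNIV"
proof -
  note T = T_Ass_eq_I'[OF assms(2)]
  have "coset ` (form_a q \<union> form_b q \<union> form_c q \<union> form_d q)
      = (\<lambda>(M, N). coset (yzmon M N :: 'k free_jordan)) ` reduced q"
    unfolding assms(1)
    by (rule subset_antisym[OF coset_forms_subset[OF assms(2) T] reduced_subset_coset_forms[OF assms(2) T]])
  then show ?thesis
    using T independent_coset_reduced[OF assms(2)] span_coset_reduced[OF assms(2)]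
    by (simp add: assms(1))
qed

end
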